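(* Let $X$ be a connected and locally path connected space and $x\in X$. If $\pi_1^{sp}(X,x)=1$, then the topology of $\pi_1^{\tau}(X,x)$ is $T_1$.
   Context: Spanier group: for an open cover $\mathcal{U}$ of $X$, $\pi(\mathcal{U},x)\le\pi_1(X,x)$ is the subgroup of classes having a representative of the form $\prod_{j=1}^n u_j v_j u_j^{-1}$, with $u_j$ a path starting at $x$ and $v_j$ a loop based at $u_j(1)$ lying inside some $U_j\in\mathcal{U}$. Then $\pi_1^{sp}(X,x)=\bigcap_{\mathcal{U}}\pi(\mathcal{U},x)$ over all open covers $\mathcal{U}$. $\pi_1^{qtop}(X,x)$ is the group $\pi_1(X,x)$ with the quotient topology induced by the natural map $\Omega(X,x)\to\pi_1(X,x)$ from the loop space with the compact-open topology. $\pi_1^{\tau}(X,x)$ (Brazas) is the group $\pi_1(X,x)$ with the finest topology that is coarser than (or equal to) the topology of $\pi_1^{qtop}(X,x)$ and makes $\pi_1(X,x)$ a topological group. *)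

theory Defs
  imports "HOL-Analysis.Analysis" "HOL-Algebra.Group"
begin

section \<open>The compact-open topology and loop spaces\<close>

text \<open>Maps on \<open>topspace X\<close> are made unique as HOL functions by being \<open>undefined\<close> elsewhere.\<close>

definition cont_maps :: "'a topology \<Rightarrow> 'b topology \<Rightarrow> ('a \<Rightarrow> 'b) set" where
  "cont_maps X Y = {f \<in> extensional (topspace X). continuous_map X Y f}"

definition compact_open_topology :: "'a topology \<Rightarrow> 'b topology \<Rightarrow> ('a \<Rightarrow> 'b) topology" where
  "compact_open_topology X Y =
     topology_generated_by {{f \<in> cont_maps X Y. f ` K \<subseteq> U} | K U. compactin X K \<and> openin Y U}"

abbreviation unit_interval :: "real topology" where
  "unit_interval \<equiv> top_of_set {0..1}"

definition loops :: "'a topology \<Rightarrow> 'a \<Rightarrow> (real \<Rightarrow> 'a) set" where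
  "loops X x = {p \<in> cont_maps unit_interval X. p 0 = x \<and> p 1 = x}"

definition loop_space :: "'a topology \<Rightarrow> 'a \<Rightarrow> (real \<Rightarrow> 'a) topology" where
  "loop_space X x = subtopology (compact_open_topology unit_interval X) (loops X x)"

lemma topspace_compact_open_topology [simp]:
  "topspace (compact_open_topology X Y) = cont_maps X Y"
proof -
  have "\<exists>K U. cont_maps X Y = {f \<in> cont_maps X Y. f ` K \<subseteq> U} \<and> compactin X K \<and> openin Y U"
    by (rule exI[of _ "{}"], rule exI[of _ "{}"]) auto
  then show ?thesis
    unfolding compact_open_topology_def topology_generated_by_topspace by blast
qed

lemma topspace_loop_space [simp]: "topspace (loop_space X x) = loops X x"
  by (auto simp: loop_space_def loops_def)

section \<open>The fundamental group\<close>

text \<open>The library's \<open>joinpaths\<close>, \<open>reversepath\<close> and \<open>homotopic_paths\<close> are restricted to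
  the type class \<open>topological_space\<close>; these are their analogues for an arbitrary topology.\<close>

definition path_join :: "(real \<Rightarrow> 'a) \<Rightarrow> (real \<Rightarrow> 'a) \<Rightarrow> real \<Rightarrow> 'a" where
  "path_join p q = (\<lambda>t\<in>{0..1}. if t \<le> 1/2 then p (2 * t) else q (2 * t - 1))"

definition path_rev :: "(real \<Rightarrow> 'a) \<Rightarrow> real \<Rightarrow> 'a" where
  "path_rev p = (\<lambda>t\<in>{0..1}. p (1 - t))"

definition loop_homotopy :: "'a topology \<Rightarrow> 'a \<Rightarrow> ((real \<Rightarrow> 'a) \<times> (real \<Rightarrow> 'a)) set" where
  "loop_homotopy X x = {(p, q). p \<in> loops X x \<and> q \<in> loops X x \<and>
     homotopic_with (\<lambda>r. r 0 = x \<and> r 1 = x) unit_interval X p q}"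

definition loop_class :: "'a topology \<Rightarrow> 'a \<Rightarrow> (real \<Rightarrow> 'a) \<Rightarrow> (real \<Rightarrow> 'a) set" where
  "loop_class X x p = loop_homotopy X x `` {p}"

text \<open>The union in \<open>mult\<close> is over equal classes: it is \<open>loop_class X x (path_join p q)\<close>
  for any choice of \<open>p \<in> A\<close> and \<open>q \<in> B\<close>.\<close>

definition fundamental_group :: "'a topology \<Rightarrow> 'a \<Rightarrow> (real \<Rightarrow> 'a) set monoid" where
  "fundamental_group X x =
     \<lparr>carrier = loops X x // loop_homotopy X x,
      mult = (\<lambda>A B. \<Union>p\<in>A. \<Union>q\<in>B. loop_class X x (path_join p q)),
      one = loop_class X x (\<lambda>t\<in>{0..1}. x)\<rparr>"

section \<open>The Spanier group\<close>

definition open_cover :: "'a topology \<Rightarrow> 'a set set \<Rightarrow> bool" where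
  "open_cover X \<U> \<longleftrightarrow> (\<forall>U\<in>\<U>. openin X U) \<and> \<Union>\<U> = topspace X"

text \<open>The products of one or more loops of the form \<open>u v u\<^sup>-\<^sup>1\<close>; the empty product is not needed,
  as the constant loop is homotopic to such a loop with \<open>u\<close> and \<open>v\<close> constant.\<close>

inductive_set spanier_loops :: "'a topology \<Rightarrow> 'a set set \<Rightarrow> 'a \<Rightarrow> (real \<Rightarrow> 'a) set"
  for X :: "'a topology" and \<U> :: "'a set set" and x :: 'a where
  single: "\<lbrakk>u \<in> cont_maps unit_interval X; u 0 = x; v \<in> loops X (u 1); U \<in> \<U>; v ` {0..1} \<subseteq> U\<rbrakk>
    \<Longrightarrow> path_join (path_join u v) (path_rev u) \<in> spanier_loops X \<U> x"
| step: "\<lbrakk>p \<in> spanier_loops X \<U> x;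
      u \<in> cont_maps unit_interval X; u 0 = x; v \<in> loops X (u 1); U \<in> \<U>; v ` {0..1} \<subseteq> U\<rbrakk>
    \<Longrightarrow> path_join p (path_join (path_join u v) (path_rev u)) \<in> spanier_loops X \<U> x"

definition spanier_group_cover :: "'a topology \<Rightarrow> 'a set set \<Rightarrow> 'a \<Rightarrow> (real \<Rightarrow> 'a) set set" where
  "spanier_group_cover X \<U> x =
     {c \<in> carrier (fundamental_group X x). \<exists>p\<in>c. p \<in> spanier_loops X \<U> x}"

definition spanier_group :: "'a topology \<Rightarrow> 'a \<Rightarrow> (real \<Rightarrow> 'a) set set" where
  "spanier_group X x = (\<Inter>\<U>\<in>{\<U>. open_cover X \<U>}. spanier_group_cover X \<U> x)"

section \<open>Topologies on the fundamental group\<close>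

definition quotient_topology :: "'a topology \<Rightarrow> ('a \<Rightarrow> 'b) \<Rightarrow> 'b topology" where
  "quotient_topology X f =
     topology (\<lambda>V. V \<subseteq> f ` topspace X \<and> openin X {p \<in> topspace X. f p \<in> V})"

lemma openin_quotient_topology:
  "openin (quotient_topology X f) V \<longleftrightarrow>
     V \<subseteq> f ` topspace X \<and> openin X {p \<in> topspace X. f p \<in> V}"
proof -
  have "istopology (\<lambda>V. V \<subseteq> f ` topspace X \<and> openin X {p \<in> topspace X. f p \<in> V})"
    unfolding istopology_def
  proof (intro conjI allI impI)
    fix S T assume "S \<subseteq> f ` topspace X \<and> openin X {p \<in> topspace X. f p \<in> S}"
      and "T \<subseteq> f ` topspace X \<and> openin X {p \<in> topspace X. f p \<in> T}"
    moreover have "{p \<in> topspace X. f p \<in> S \<inter> T} =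
        {p \<in> topspace X. f p \<in> S} \<inter> {p \<in> topspace X. f p \<in> T}" by blast
    ultimately show "S \<inter> T \<subseteq> f ` topspace X" "openin X {p \<in> topspace X. f p \<in> S \<inter> T}"
      by auto
  next
    fix \<K> assume *: "\<forall>K\<in>\<K>. K \<subseteq> f ` topspace X \<and> openin X {p \<in> topspace X. f p \<in> K}"
    have "{p \<in> topspace X. f p \<in> \<Union>\<K>} = (\<Union>K\<in>\<K>. {p \<in> topspace X. f p \<in> K})" by blast
    with * show "\<Union>\<K> \<subseteq> f ` topspace X" "openin X {p \<in> topspace X. f p \<in> \<Union>\<K>}"
      by auto
  qed
  then show ?thesis
    by (simp add: quotient_topology_def)
qed

lemma topspace_quotient_topology [simp]:
  "topspace (quotient_topology X f) = f ` topspace X"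
proof
  show "topspace (quotient_topology X f) \<subseteq> f ` topspace X"
    by (meson openin_quotient_topology openin_topspace)
  have "{p \<in> topspace X. f p \<in> f ` topspace X} = topspace X" by blast
  then have "openin (quotient_topology X f) (f ` topspace X)"
    by (simp add: openin_quotient_topology)
  then show "f ` topspace X \<subseteq> topspace (quotient_topology X f)"
    by (rule openin_subset)
qed

definition topological_group :: "('a, 'b) monoid_scheme \<Rightarrow> 'a topology \<Rightarrow> bool" where
  "topological_group G T \<longleftrightarrow> group G \<and> topspace T = carrier G \<and>
     continuous_map (prod_topology T T) T (\<lambda>(a, b). a \<otimes>\<^bsub>G\<^esub> b) \<and>
     continuous_map T T (\<lambda>a. inv\<^bsub>G\<^esub> a)"

definition coarser :: "'a topology \<Rightarrow> 'a topology \<Rightarrow> bool" where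
  "coarser T T' \<longleftrightarrow> topspace T = topspace T' \<and> (\<forall>U. openin T U \<longrightarrow> openin T' U)"

definition is_finest_group_topology ::
    "('a, 'b) monoid_scheme \<Rightarrow> 'a topology \<Rightarrow> 'a topology \<Rightarrow> bool" where
  "is_finest_group_topology G S T \<longleftrightarrow> topological_group G T \<and> coarser T S \<and>
     (\<forall>T'. topological_group G T' \<and> coarser T' S \<longrightarrow> coarser T' T)"

definition finest_group_topology ::
    "('a, 'b) monoid_scheme \<Rightarrow> 'a topology \<Rightarrow> 'a topology" where
  "finest_group_topology G S = (THE T. is_finest_group_topology G S T)"

lemma continuous_map_into_indiscrete:
  assumes "f \<in> topspace Z \<rightarrow> A"
  shows "continuous_map Z (topology_generated_by {A}) f"
  unfolding continuous_on_generated_topo_iff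
proof (intro conjI allI impI)
  fix U assume "U \<in> {A}"
  then have "f -` U \<inter> topspace Z = topspace Z" using assms by auto
  then show "openin Z (f -` U \<inter> topspace Z)" by simp
qed (use assms in auto)

lemma continuous_map_into_generated:
  assumes "T\<^sub>0 \<in> \<T>" and f: "\<And>T. T \<in> \<T> \<Longrightarrow> continuous_map Z T f"
  shows "continuous_map Z (topology_generated_by {U. \<exists>T\<in>\<T>. openin T U}) f"
  unfolding continuous_on_generated_topo_iff
proof (intro conjI allI impI)
  fix U assume "U \<in> {U. \<exists>T\<in>\<T>. openin T U}"
  then obtain T where T: "T \<in> \<T>" "openin T U" by auto
  then have "openin Z {z \<in> topspace Z. f z \<in> U}"
    using f[OF T(1)] by (auto simp: continuous_map_def)
  moreover have "f -` U \<inter> topspace Z = {z \<in> topspace Z. f z \<in> U}" by auto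
  ultimately show "openin Z (f -` U \<inter> topspace Z)" by simp
next
  have "f \<in> topspace Z \<rightarrow> topspace T\<^sub>0"
    using f[OF assms(1)] by (auto simp: continuous_map_def)
  then show "f ` topspace Z \<subseteq> \<Union>{U. \<exists>T\<in>\<T>. openin T U}"
    using assms(1) openin_topspace[of T\<^sub>0] by blast
qed

lemma ex1_finest_group_topology:
  assumes "group G" and S: "topspace S = carrier G"
  shows "\<exists>!T. is_finest_group_topology G S T"
proof (rule ex_ex1I)
  interpret group G by fact
  define \<T> where "\<T> = {T. topological_group G T \<and> coarser T S}"
  define I where "I = topology_generated_by {carrier G}"
  have mult_in: "(\<lambda>(a, b). a \<otimes>\<^bsub>G\<^esub> b) \<in> carrier G \<times> carrier G \<rightarrow> carrier G"
    by auto
  have I_top: "topspace I = carrier G"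
    unfolding I_def topology_generated_by_topspace by simp
  have I_open: "openin T U" if "openin I U" "topspace T = carrier G" for T U
  proof -
    from that(1) have "generate_topology_on {carrier G} U"
      unfolding I_def by (rule openin_topology_generated_by)
    then show ?thesis
      by induction (use that(2) in \<open>auto intro: openin_topspace[of T, unfolded that(2)]\<close>)
  qed
  note I_cont = continuous_map_into_indiscrete[of _ _ "carrier G", folded I_def]
  have "topological_group G I"
    unfolding topological_group_def using \<open>group G\<close> I_top mult_in
    by (simp add: I_cont Pi_iff)
  then have I: "I \<in> \<T>"
    using I_open S I_top by (auto simp: \<T>_def coarser_def)
  define \<B> where "\<B> = {U. \<exists>T\<in>\<T>. openin T U}"
  define M where "M = topology_generated_by \<B>"
  have top\<T>: "topspace T = carrier G" if "T \<in> \<T>" for T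
    using that by (auto simp: \<T>_def topological_group_def)
  have "\<Union>\<B> = carrier G"
  proof
    show "\<Union>\<B> \<subseteq> carrier G"
    proof
      fix a assume "a \<in> \<Union>\<B>"
      then obtain T U where "T \<in> \<T>" "openin T U" "a \<in> U" by (auto simp: \<B>_def)
      then show "a \<in> carrier G" using top\<T> openin_subset by blast
    qed
    show "carrier G \<subseteq> \<Union>\<B>"
      using I I_top openin_topspace[of I] by (auto simp: \<B>_def)
  qed
  then have M_top: "topspace M = carrier G"
    unfolding M_def topology_generated_by_topspace .
  have M_open: "openin M U" if "openin T U" "T \<in> \<T>" for T U
    unfolding M_def by (rule topology_generated_by_Basis) (use that in \<open>auto simp: \<B>_def\<close>)
  have M_id: "continuous_map M T (\<lambda>a. a)" if "T \<in> \<T>" for T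
    unfolding continuous_map_def
  proof (intro conjI allI impI)
    fix U assume U: "openin T U"
    then have "{a \<in> topspace M. a \<in> U} = U"
      using M_top top\<T>[OF that] openin_subset[OF U] by auto
    then show "openin M {a \<in> topspace M. a \<in> U}"
      using M_open[OF U that] by simp
  qed (use M_top top\<T>[OF that] in auto)
  have "topological_group G M"
    unfolding topological_group_def
  proof (intro conjI)
    show "continuous_map (prod_topology M M) M (\<lambda>(a, b). a \<otimes>\<^bsub>G\<^esub> b)"
    proof (rule continuous_map_into_generated[OF I, folded \<B>_def, folded M_def])
      fix T assume T: "T \<in> \<T>"
      have "continuous_map (prod_topology M M) (prod_topology T T) (\<lambda>(a, b). (a, b))"
        by (rule continuous_map_prod_top[THEN iffD2]) (simp add: M_id[OF T])
      moreover have "continuous_map (prod_topology T T) T (\<lambda>(a, b). a \<otimes>\<^bsub>G\<^esub> b)"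
        using T by (auto simp: \<T>_def topological_group_def)
      ultimately have "continuous_map (prod_topology M M) T
          ((\<lambda>(a, b). a \<otimes>\<^bsub>G\<^esub> b) \<circ> (\<lambda>(a, b). (a, b)))"
        by (rule continuous_map_compose)
      then show "continuous_map (prod_topology M M) T (\<lambda>(a, b). a \<otimes>\<^bsub>G\<^esub> b)"
        by (simp add: o_def case_prod_unfold)
    qed
    show "continuous_map M M (\<lambda>a. inv\<^bsub>G\<^esub> a)"
    proof (rule continuous_map_into_generated[OF I, folded \<B>_def, folded M_def])
      fix T assume T: "T \<in> \<T>"
      have "continuous_map T T (\<lambda>a. inv\<^bsub>G\<^esub> a)"
        using T by (auto simp: \<T>_def topological_group_def)
      from continuous_map_compose[OF M_id[OF T] this]
      show "continuous_map M T (\<lambda>a. inv\<^bsub>G\<^esub> a)" by (simp add: o_def)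
    qed
  qed (use \<open>group G\<close> M_top in auto)
  moreover have "openin S U" if "openin M U" for U
  proof -
    from that have "generate_topology_on \<B> U"
      unfolding M_def by (rule openin_topology_generated_by)
    then show ?thesis
      by induction (auto simp: \<B>_def \<T>_def coarser_def)
  qed
  ultimately have "is_finest_group_topology G S M"
    using M_open M_top S by (auto simp: is_finest_group_topology_def coarser_def \<T>_def)
  then show "\<exists>T. is_finest_group_topology G S T" ..
next
  fix T T' assume "is_finest_group_topology G S T" "is_finest_group_topology G S T'"
  then have "coarser T T'" "coarser T' T"
    by (simp_all add: is_finest_group_topology_def)
  then show "T = T'"
    unfolding topology_eq coarser_def by auto
qed

definition pi1_qtop :: "'a topology \<Rightarrow> 'a \<Rightarrow> (real \<Rightarrow> 'a) set topology" where
  "pi1_qtop X x = quotient_topology (loop_space X x) (loop_class X x)"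

lemma topspace_pi1_qtop: "topspace (pi1_qtop X x) = carrier (fundamental_group X x)"
  by (auto simp: pi1_qtop_def fundamental_group_def quotient_def loop_class_def)

definition pi1_tau :: "'a topology \<Rightarrow> 'a \<Rightarrow> (real \<Rightarrow> 'a) set topology" where
  "pi1_tau X x = finest_group_topology (fundamental_group X x) (pi1_qtop X x)"

end

theory Submission
  imports Defs "HOL-Algebra.Generated_Groups"
begin

text \<open>The Spanier subgroup \<open>N\<close> of an open cover is normal, so its cosets are a basis of a group
  topology. In a locally path connected space a loop \<open>q\<close> close to \<open>p\<close> in the compact-open topology
  differs from \<open>p\<close> by an element of \<open>N\<close>: on short intervals \<open>p\<close> and \<open>q\<close> lie in a common member of
  the cover, and their end points are joined by short paths. Hence the coset topology is coarser than
  the quotient topology, and therefore coarser than that of \<open>\<pi>\<^sub>1\<^sup>\<tau>\<close>. If the Spanier groups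
  intersect trivially, then two distinct classes \<open>a\<close> and \<open>b\<close> satisfy \<open>b a\<^sup>-\<^sup>1 \<notin> N\<close> for some
  cover, and the open coset \<open>N a\<close> contains \<open>a\<close> but not \<open>b\<close>.\<close>

section \<open>Path homotopy\<close>

text \<open>On a subinterval, \<open>p\<close> and \<open>q\<close> have end points that are neither
  the base point nor equal to each other, so their comparison cannot be stated inside the
  fundamental group. It is carried out in the fundamental groupoid instead, where equality modulo
  \<open>N\<close> is extended to classes between arbitrary points by pulling back to
  \<open>x\<close> along connecting paths (\<open>spanier_cong\<close>). A second obstacle is that
  the neighbourhood of \<open>p\<close> has to be fixed before \<open>q\<close> is known, while the
  short path leaving one interval must land in the neighbourhood that the next interval prescribes.
  The quantifier order of \<open>comparable_on\<close> takes care of this and makes the property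
  additive under concatenation, so that bisection of the unit interval can stand in for an explicit
  subdivision by a Lebesgue number.\<close>

abbreviation paths :: "'a topology \<Rightarrow> (real \<Rightarrow> 'a) set" where
  "paths X \<equiv> cont_maps unit_interval X"

text \<open>The end points are those of \<open>p\<close> instead of a fixed base point, so that the
  relation covers paths between arbitrary points; on loops at \<open>x\<close> it specializes to
  \<open>loop_homotopy\<close>. The end points of \<open>q\<close> need no separate condition,
  because the invariant of \<open>homotopic_with\<close> also holds for \<open>q\<close>.\<close>

definition path_homotopy :: "'a topology \<Rightarrow> ((real \<Rightarrow> 'a) \<times> (real \<Rightarrow> 'a)) set" where
  "path_homotopy X = {(p, q). p \<in> paths X \<and> q \<in> paths X \<and>
     homotopic_with (\<lambda>r. r 0 = p 0 \<and> r 1 = p 1) unit_interval X p q}"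

lemma restrict_in_paths:
  assumes "continuous_map unit_interval X f"
  shows "restrict f {0..1} \<in> paths X"
  using assms continuous_map_eq[OF assms, of "restrict f {0..1}"] by (auto simp: cont_maps_def)

lemma paths_eqI:
  assumes "p \<in> paths X" "q \<in> paths X" "\<And>t. t \<in> {0..1} \<Longrightarrow> p t = q t"
  shows "p = q"
  using assms by (auto simp: cont_maps_def intro: extensionalityI)

lemma path_in_topspace: "p \<in> paths X \<Longrightarrow> t \<in> {0..1} \<Longrightarrow> p t \<in> topspace X"
  by (auto simp: cont_maps_def continuous_map_def)

text \<open>Puts the homotopy on a square in \<open>real \<times> real\<close>, where continuity of
  explicit coordinate changes can be proved by the usual rules for real functions.\<close>

lemma path_homotopy_iff:
  "(p, q) \<in> path_homotopy X \<longleftrightarrow> p \<in> paths X \<and> q \<in> paths X \<and>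
     (\<exists>H. continuous_map (top_of_set ({0..1::real} \<times> {0..1::real})) X H \<and>
       (\<forall>t\<in>{0..1}. H (0, t) = p t \<and> H (1, t) = q t) \<and>
       (\<forall>s\<in>{0..1::real}. H (s, 0) = p 0 \<and> H (s, 1) = p 1))"
proof -
  have "homotopic_with (\<lambda>r. r 0 = p 0 \<and> r 1 = p 1) unit_interval X p q \<longleftrightarrow>
     (\<exists>H. continuous_map (prod_topology unit_interval unit_interval) X H \<and>
       (\<forall>t\<in>topspace unit_interval. H (0, t) = p t) \<and>
       (\<forall>t\<in>topspace unit_interval. H (1, t) = q t) \<and>
       (\<forall>s\<in>{0..1::real}. H (s, 0) = p 0 \<and> H (s, 1) = p 1))"
    by (rule homotopic_with) auto
  then show ?thesis by (auto simp: path_homotopy_def ball_conj_distrib)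
qed

lemma path_homotopy_ends:
  assumes "(p, q) \<in> path_homotopy X"
  shows "q 0 = p 0" "q 1 = p 1"
proof -
  have "homotopic_with (\<lambda>r. r 0 = p 0 \<and> r 1 = p 1) unit_interval X p q"
    using assms by (simp add: path_homotopy_def)
  from homotopic_with_imp_property[OF this] show "q 0 = p 0" "q 1 = p 1" by simp_all
qed

lemma equiv_path_homotopy: "equiv (paths X) (path_homotopy X)"
proof (rule equivI)
  show "path_homotopy X \<subseteq> paths X \<times> paths X" by (auto simp: path_homotopy_def)
  show "refl_on (paths X) (path_homotopy X)"
    by (auto simp: refl_on_def path_homotopy_def cont_maps_def)
  show "sym (path_homotopy X)"
  proof (rule symI)
    fix p q assume "(p, q) \<in> path_homotopy X"
    with path_homotopy_ends[OF this] show "(q, p) \<in> path_homotopy X"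
      by (auto simp: path_homotopy_def intro: homotopic_with_symD)
  qed
  show "trans (path_homotopy X)"
  proof (rule transI)
    fix p q r assume "(p, q) \<in> path_homotopy X" "(q, r) \<in> path_homotopy X"
    with path_homotopy_ends[OF this(1)] show "(p, r) \<in> path_homotopy X"
      by (auto simp: path_homotopy_def intro: homotopic_with_trans)
  qed
qed

text \<open>The unit interval is convex, so \<open>\<phi>\<close> and \<open>\<psi>\<close> are
  joined by a straight-line homotopy \<open>\<theta>\<close> in the parameter domain; composing with
  \<open>f\<close> carries it to \<open>X\<close>. Equality of \<open>\<phi>\<close> and
  \<open>\<psi>\<close> at 0 and 1 keeps the end points fixed.\<close>

lemma path_homotopy_reparametrize:
  assumes f: "continuous_map unit_interval X f"
    and "continuous_on {0..1} \<phi>" "\<phi> \<in> {0..1} \<rightarrow> {0..1}"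
    and "continuous_on {0..1} \<psi>" "\<psi> \<in> {0..1} \<rightarrow> {0..1}"
    and "\<phi> 0 = \<psi> 0" "\<phi> 1 = \<psi> 1"
  shows "(\<lambda>t\<in>{0..1}. f (\<phi> t), \<lambda>t\<in>{0..1}. f (\<psi> t)) \<in> path_homotopy X"
proof -
  have paths: "(\<lambda>t\<in>{0..1}. f (\<eta> t)) \<in> paths X"
    if "continuous_on {0..1} \<eta>" "\<eta> \<in> {0..1} \<rightarrow> {0..1}" for \<eta> :: "real \<Rightarrow> real"
  proof (rule restrict_in_paths)
    have "continuous_map unit_interval unit_interval \<eta>"
      using that by (simp add: continuous_map_subtopology_eu)
    from continuous_map_compose[OF this f]
    show "continuous_map unit_interval X (\<lambda>t. f (\<eta> t))" by (simp add: o_def)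
  qed
  define \<theta> where "\<theta> = (\<lambda>z::real\<times>real. (1 - fst z) * \<phi> (snd z) + fst z * \<psi> (snd z))"
  have "continuous_on ({0..1} \<times> {0..1}) \<theta>"
    unfolding \<theta>_def
    by (intro continuous_intros continuous_on_compose2[OF assms(2)]
        continuous_on_compose2[OF assms(4)]) auto
  moreover have "\<theta> z \<in> {0..1}" if "z \<in> {0..1} \<times> {0..1}" for z
  proof -
    have "fst z \<in> {0..1}" "\<phi> (snd z) \<in> {0..1}" "\<psi> (snd z) \<in> {0..1}"
      using that assms(3,5) by auto
    then show ?thesis
      using convexD[of "{0..1::real}" "\<phi> (snd z)" "\<psi> (snd z)" "1 - fst z" "fst z"]
      by (auto simp: \<theta>_def)
  qed
  ultimately have "continuous_map (top_of_set ({0..1} \<times> {0..1})) unit_interval \<theta>"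
    by (auto simp: continuous_map_subtopology_eu)
  from continuous_map_compose[OF this f]
  have "continuous_map (top_of_set ({0..1} \<times> {0..1})) X (f \<circ> \<theta>)" .
  moreover have "f (\<theta> (s, 0)) = f (\<phi> 0)" "f (\<theta> (s, 1)) = f (\<phi> 1)" for s
    using assms(6,7) by (auto simp: \<theta>_def algebra_simps)
  ultimately show ?thesis
    unfolding path_homotopy_iff using paths assms
    by (auto intro!: exI[of _ "f \<circ> \<theta>"] simp: \<theta>_def)
qed

lemma path_join_in_paths [intro]:
  assumes p: "p \<in> paths X" and q: "q \<in> paths X" and pq: "p 1 = q 0"
  shows "path_join p q \<in> paths X"
  unfolding path_join_def
proof (rule restrict_in_paths, rule continuous_map_cases_le)
  have p': "continuous_map unit_interval X p" and q': "continuous_map unit_interval X q"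
    using p q by (auto simp: cont_maps_def)
  have *: "continuous_map (subtopology unit_interval {t \<in> topspace unit_interval. t \<le> 1/2})
      unit_interval (\<lambda>t. 2 * t)"
    by (auto simp: subtopology_subtopology continuous_map_subtopology_eu intro!: continuous_intros)
  show "continuous_map (subtopology unit_interval {t \<in> topspace unit_interval. t \<le> 1/2}) X
      (\<lambda>t. p (2 * t))"
    using continuous_map_compose[OF * p'] by (simp add: o_def)
  have *: "continuous_map (subtopology unit_interval {t \<in> topspace unit_interval. 1/2 \<le> t})
      unit_interval (\<lambda>t. 2 * t - 1)"
    by (auto simp: subtopology_subtopology continuous_map_subtopology_eu intro!: continuous_intros)
  show "continuous_map (subtopology unit_interval {t \<in> topspace unit_interval. 1/2 \<le> t}) X
      (\<lambda>t. q (2 * t - 1))"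
    using continuous_map_compose[OF * q'] by (simp add: o_def)
  show "p (2 * t) = q (2 * t - 1)" if "t = 1/2" for t
    unfolding that by (simp add: pq)
qed (auto intro!: continuous_intros)

lemma path_join_ends [simp]: "path_join p q 0 = p 0" "path_join p q 1 = q 1"
  by (auto simp: path_join_def)

lemma path_rev_in_paths [intro]:
  assumes "p \<in> paths X" shows "path_rev p \<in> paths X"
  unfolding path_rev_def
proof (rule restrict_in_paths)
  have *: "continuous_map unit_interval unit_interval (\<lambda>t. 1 - t)"
    by (auto simp: continuous_map_subtopology_eu intro!: continuous_intros)
  show "continuous_map unit_interval X (\<lambda>t. p (1 - t))"
    using continuous_map_compose[OF *, of X p] assms by (simp add: o_def cont_maps_def)
qed

lemma path_rev_ends [simp]: "path_rev p 0 = p 1" "path_rev p 1 = p 0"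
  by (auto simp: path_rev_def)

lemma const_in_paths [intro]: "y \<in> topspace X \<Longrightarrow> (\<lambda>t\<in>{0..1}. y) \<in> paths X"
  by (rule restrict_in_paths) simp

text \<open>The two homotopies run side by side on the halves of the square. On the line
  \<open>snd z = 1/2\<close> they agree, since both are fixed there at the common point
  \<open>p 1 = q 0\<close>.\<close>

lemma path_homotopy_join:
  assumes p: "(p, p') \<in> path_homotopy X" and q: "(q, q') \<in> path_homotopy X" and pq: "p 1 = q 0"
  shows "(path_join p q, path_join p' q') \<in> path_homotopy X"
proof -
  let ?I = "{0..1} \<times> {0..1} :: (real \<times> real) set"
  obtain H where H: "continuous_map (top_of_set ?I) X H"
    and H0: "\<And>t. t \<in> {0..1} \<Longrightarrow> H (0, t) = p t \<and> H (1, t) = p' t"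
    and H1: "\<And>s. s \<in> {0..1} \<Longrightarrow> H (s, 0) = p 0 \<and> H (s, 1) = p 1"
    using p unfolding path_homotopy_iff by blast
  obtain K where K: "continuous_map (top_of_set ?I) X K"
    and K0: "\<And>t. t \<in> {0..1} \<Longrightarrow> K (0, t) = q t \<and> K (1, t) = q' t"
    and K1: "\<And>s. s \<in> {0..1} \<Longrightarrow> K (s, 0) = q 0 \<and> K (s, 1) = q 1"
    using q unfolding path_homotopy_iff by blast
  have paths: "p \<in> paths X" "p' \<in> paths X" "q \<in> paths X" "q' \<in> paths X"
    using p q by (auto simp: path_homotopy_iff)
  have ends: "p' 1 = p 1" "q' 0 = q 0"
    using path_homotopy_ends p q by metis+
  define J where "J = (\<lambda>z. if snd z \<le> 1/2 then H (fst z, 2 * snd z) else K (fst z, 2 * snd z - 1))"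
  have "continuous_map (top_of_set ?I) X J"
    unfolding J_def
  proof (rule continuous_map_cases_le)
    have *: "continuous_map (subtopology (top_of_set ?I) {z \<in> topspace (top_of_set ?I). snd z \<le> 1/2})
      (top_of_set ?I) (\<lambda>z. (fst z, 2 * snd z))"
      by (auto simp: subtopology_subtopology continuous_map_subtopology_eu intro!: continuous_intros)
    show "continuous_map (subtopology (top_of_set ?I) {z \<in> topspace (top_of_set ?I). snd z \<le> 1/2}) X
      (\<lambda>z. H (fst z, 2 * snd z))"
      using continuous_map_compose[OF * H] by (simp add: o_def)
    have *: "continuous_map (subtopology (top_of_set ?I) {z \<in> topspace (top_of_set ?I). 1/2 \<le> snd z})
      (top_of_set ?I) (\<lambda>z. (fst z, 2 * snd z - 1))"
      by (auto simp: subtopology_subtopology continuous_map_subtopology_eu intro!: continuous_intros)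
    show "continuous_map (subtopology (top_of_set ?I) {z \<in> topspace (top_of_set ?I). 1/2 \<le> snd z}) X
      (\<lambda>z. K (fst z, 2 * snd z - 1))"
      using continuous_map_compose[OF * K] by (simp add: o_def)
    show "H (fst z, 2 * snd z) = K (fst z, 2 * snd z - 1)"
      if "z \<in> topspace (top_of_set ?I)" "snd z = 1/2" for z
      unfolding that(2) using that(1) H1[of "fst z"] K1[of "fst z"] pq by auto
  qed (auto simp: continuous_map_subtopology_eu intro!: continuous_intros)
  then show ?thesis
    unfolding path_homotopy_iff using paths pq ends H0 H1 K0 K1
    by (auto intro!: exI[of _ J] path_join_in_paths) (auto simp: J_def path_join_def)
qed

lemma path_homotopy_rev:
  assumes "(p, q) \<in> path_homotopy X"
  shows "(path_rev p, path_rev q) \<in> path_homotopy X"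
proof -
  let ?I = "{0..1} \<times> {0..1} :: (real \<times> real) set"
  obtain H where H: "continuous_map (top_of_set ?I) X H"
    and H0: "\<And>t. t \<in> {0..1} \<Longrightarrow> H (0, t) = p t \<and> H (1, t) = q t"
    and H1: "\<And>s. s \<in> {0..1} \<Longrightarrow> H (s, 0) = p 0 \<and> H (s, 1) = p 1"
    using assms unfolding path_homotopy_iff by blast
  have *: "continuous_map (top_of_set ?I) (top_of_set ?I) (\<lambda>z. (fst z, 1 - snd z))"
    by (auto simp: continuous_map_subtopology_eu intro!: continuous_intros)
  show ?thesis
    unfolding path_homotopy_iff
    using continuous_map_compose[OF * H] assms H0 H1
    by (auto intro!: exI[of _ "H \<circ> (\<lambda>z. (fst z, 1 - snd z))"] simp: path_rev_def path_homotopy_iff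
        path_rev_in_paths[unfolded path_rev_def])
qed

section \<open>The fundamental groupoid\<close>

context
  fixes X :: "'a topology"
begin

definition path_class :: "(real \<Rightarrow> 'a) \<Rightarrow> (real \<Rightarrow> 'a) set" where
  "path_class p = path_homotopy X `` {p}"

definition path_classes :: "'a \<Rightarrow> 'a \<Rightarrow> (real \<Rightarrow> 'a) set set" where
  "path_classes y z = path_class ` {p \<in> paths X. p 0 = y \<and> p 1 = z}"

text \<open>The union over representatives copies the shape of \<open>mult\<close> in
  \<open>fundamental_group\<close>, so that both products agree on loops by unfolding. It is a union
  of equal sets as soon as the paths are composable.\<close>

definition class_comp :: "(real \<Rightarrow> 'a) set \<Rightarrow> (real \<Rightarrow> 'a) set \<Rightarrow> (real \<Rightarrow> 'a) set" (infixl "\<cdot>" 70)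
  where "A \<cdot> B = (\<Union>p\<in>A. \<Union>q\<in>B. path_class (path_join p q))"

definition class_inv :: "(real \<Rightarrow> 'a) set \<Rightarrow> (real \<Rightarrow> 'a) set" where
  "class_inv A = (\<Union>p\<in>A. path_class (path_rev p))"

definition class_one :: "'a \<Rightarrow> (real \<Rightarrow> 'a) set" where
  "class_one y = path_class (\<lambda>t\<in>{0..1}. y)"

lemma path_class_eq: "(p, q) \<in> path_homotopy X \<Longrightarrow> path_class p = path_class q"
  unfolding path_class_def by (rule equiv_class_eq[OF equiv_path_homotopy])

lemma path_class_self: "p \<in> paths X \<Longrightarrow> p \<in> path_class p"
  unfolding path_class_def by (rule equiv_class_self[OF equiv_path_homotopy])

lemma in_path_class: "q \<in> path_class p \<Longrightarrow> (p, q) \<in> path_homotopy X"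
  by (simp add: path_class_def)

lemma path_class_in_path_classes [intro]:
  "p \<in> paths X \<Longrightarrow> p 0 = y \<Longrightarrow> p 1 = z \<Longrightarrow> path_class p \<in> path_classes y z"
  by (auto simp: path_classes_def)

lemma path_classesE:
  assumes "A \<in> path_classes y z"
  obtains p where "p \<in> paths X" "p 0 = y" "p 1 = z" "A = path_class p"
  using assms by (auto simp: path_classes_def)

lemma class_comp_path_class:
  assumes "p \<in> paths X" "q \<in> paths X" "p 1 = q 0"
  shows "path_class p \<cdot> path_class q = path_class (path_join p q)"
proof -
  have "path_class (path_join p' q') = path_class (path_join p q)"
    if "p' \<in> path_class p" "q' \<in> path_class q" for p' q'
    using path_homotopy_join[OF in_path_class[OF that(1)] in_path_class[OF that(2)] assms(3)]
    by (simp add: path_class_eq)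
  moreover have "p \<in> path_class p" "q \<in> path_class q"
    using assms path_class_self by auto
  ultimately show ?thesis unfolding class_comp_def by blast
qed

lemma class_inv_path_class:
  assumes "p \<in> paths X"
  shows "class_inv (path_class p) = path_class (path_rev p)"
proof -
  have "path_class (path_rev p') = path_class (path_rev p)" if "p' \<in> path_class p" for p'
    using path_homotopy_rev[OF in_path_class[OF that]] by (simp add: path_class_eq)
  moreover have "p \<in> path_class p"
    using assms path_class_self by auto
  ultimately show ?thesis unfolding class_inv_def by blast
qed

text \<open>The source of the groupoid laws below: each of associativity, units and inverses amounts
  to writing both sides as one path \<open>f\<close> run with two different parameters.\<close>

lemma path_class_reparametrize:
  assumes f: "f \<in> paths X" and pq: "p \<in> paths X" "q \<in> paths X"
    and "continuous_on {0..1} \<phi>" "\<phi> \<in> {0..1} \<rightarrow> {0..1}"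
    and "continuous_on {0..1} \<psi>" "\<psi> \<in> {0..1} \<rightarrow> {0..1}"
    and "\<phi> 0 = \<psi> 0" "\<phi> 1 = \<psi> 1"
    and p: "\<And>t. t \<in> {0..1} \<Longrightarrow> p t = f (\<phi> t)" and q: "\<And>t. t \<in> {0..1} \<Longrightarrow> q t = f (\<psi> t)"
  shows "path_class p = path_class q"
proof (rule path_class_eq)
  have "continuous_map unit_interval X f" using f by (simp add: cont_maps_def)
  from path_homotopy_reparametrize[OF this assms(4-9)]
  have *: "(\<lambda>t\<in>{0..1}. f (\<phi> t), \<lambda>t\<in>{0..1}. f (\<psi> t)) \<in> path_homotopy X" .
  moreover have "p = (\<lambda>t\<in>{0..1}. f (\<phi> t))" "q = (\<lambda>t\<in>{0..1}. f (\<psi> t))"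
    using * pq p q by (auto intro!: paths_eqI simp: path_homotopy_def)
  ultimately show "(p, q) \<in> path_homotopy X" by simp
qed

lemma class_comp_closed [intro, simp]:
  "A \<in> path_classes y z \<Longrightarrow> B \<in> path_classes z w \<Longrightarrow> A \<cdot> B \<in> path_classes y w"
  by (auto elim!: path_classesE intro!: path_class_in_path_classes path_join_in_paths
      simp: class_comp_path_class)

lemma class_inv_closed [intro, simp]:
  "A \<in> path_classes y z \<Longrightarrow> class_inv A \<in> path_classes z y"
  by (auto elim!: path_classesE intro!: path_class_in_path_classes path_rev_in_paths
      simp: class_inv_path_class)

lemma class_one_closed [intro, simp]:
  "y \<in> topspace X \<Longrightarrow> class_one y \<in> path_classes y y"
  by (auto intro!: path_class_in_path_classes const_in_paths simp: class_one_def)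

lemma class_comp_assoc:
  assumes "A \<in> path_classes y z" "B \<in> path_classes z w" "C \<in> path_classes w v"
  shows "A \<cdot> B \<cdot> C = A \<cdot> (B \<cdot> C)"
proof -
  obtain p q r where p: "p \<in> paths X" "p 1 = z" "A = path_class p"
    and q: "q \<in> paths X" "q 0 = z" "q 1 = w" "B = path_class q"
    and r: "r \<in> paths X" "r 0 = w" "C = path_class r"
    using assms by (metis path_classesE)
  \<comment> \<open>The left side changes factors at 1/4 and 1/2, the right side at 1/2 and 3/4. The
    piecewise linear map carrying the first pair of break points to the second has slopes 2, 1 and
    1/2; it is concave, hence the minimum of its three affine pieces.\<close>
  have "path_class (path_join (path_join p q) r) = path_class (path_join p (path_join q r))"
  proof (rule path_class_reparametrize[where f = "path_join p (path_join q r)"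
        and \<phi> = "\<lambda>t. min (2 * t) (min (t + 1/4) (t/2 + 1/2))" and \<psi> = "\<lambda>t. t"])
    fix t :: real assume t: "t \<in> {0..1}"
    consider "t \<le> 1/4" | "1/4 < t" "t \<le> 1/2" | "1/2 < t" by linarith
    then show "path_join (path_join p q) r t =
        path_join p (path_join q r) (min (2 * t) (min (t + 1/4) (t/2 + 1/2)))"
    proof cases
      case 1
      then have "min (2 * t) (min (t + 1/4) (t/2 + 1/2)) = 2 * t" by auto
      with 1 t show ?thesis by (simp add: path_join_def)
    next
      case 2
      then have *: "min (2 * t) (min (t + 1/4) (t/2 + 1/2)) = t + 1/4" by auto
      have "2 * (2 * t) - 1 = 2 * (2 * (t + 1/4) - 1)" by simp
      with 2 t show ?thesis unfolding * by (simp add: path_join_def)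
    next
      case 3
      then have *: "min (2 * t) (min (t + 1/4) (t/2 + 1/2)) = t/2 + 1/2" by auto
      have "2 * (t/2 + 1/2) - 1 = t" by simp
      with 3 t show ?thesis unfolding * by (simp add: path_join_def)
    qed
  qed (use p q r in \<open>auto intro!: continuous_intros path_join_in_paths\<close>)
  then show ?thesis
    using p q r by (simp add: class_comp_path_class path_join_in_paths)
qed

lemma class_one_left [simp]:
  assumes "A \<in> path_classes y z"
  shows "class_one y \<cdot> A = A"
proof -
  obtain p where p: "p \<in> paths X" "p 0 = y" "A = path_class p"
    using assms by (metis path_classesE)
  then have y: "y \<in> topspace X" using path_in_topspace[of p X 0] by simp
  \<comment> \<open>The parameter \<open>max 0 (2 * t - 1)\<close> waits at 0 during the first half;
    for the right unit, \<open>min 1 (2 * t)\<close> waits at 1 during the second half.\<close>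
  have "path_class (path_join (\<lambda>t\<in>{0..1}. y) p) = path_class p"
  proof (rule path_class_reparametrize[where f = p and \<phi> = "\<lambda>t. max 0 (2 * t - 1)" and \<psi> = "\<lambda>t. t"])
    show "path_join (\<lambda>t\<in>{0..1}. y) p t = p (max 0 (2 * t - 1))" if "t \<in> {0..1}" for t
    proof (cases "t \<le> 1/2")
      case True
      then have "max 0 (2 * t - 1) = 0" by simp
      with True that p show ?thesis by (simp add: path_join_def)
    qed (use that p in \<open>auto simp: path_join_def\<close>)
  qed (use p y in \<open>auto intro!: continuous_intros path_join_in_paths const_in_paths\<close>)
  then show ?thesis
    using p y by (simp add: class_one_def class_comp_path_class const_in_paths)
qed

lemma class_one_right [simp]:
  assumes "A \<in> path_classes y z"
  shows "A \<cdot> class_one z = A"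
proof -
  obtain p where p: "p \<in> paths X" "p 1 = z" "A = path_class p"
    using assms by (metis path_classesE)
  then have z: "z \<in> topspace X" using path_in_topspace[of p X 1] by simp
  have "path_class (path_join p (\<lambda>t\<in>{0..1}. z)) = path_class p"
  proof (rule path_class_reparametrize[where f = p and \<phi> = "\<lambda>t. min 1 (2 * t)" and \<psi> = "\<lambda>t. t"])
    show "path_join p (\<lambda>t\<in>{0..1}. z) t = p (min 1 (2 * t))" if "t \<in> {0..1}" for t
    proof (cases "1/2 \<le> t")
      case True
      then have "min 1 (2 * t) = 1" by simp
      moreover have "2 * t = 1" if "t \<le> 1/2" using True that by simp
      ultimately show ?thesis using \<open>t \<in> {0..1}\<close> p by (simp add: path_join_def)
    qed (use that p in \<open>auto simp: path_join_def\<close>)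
  qed (use p z in \<open>auto intro!: continuous_intros path_join_in_paths const_in_paths\<close>)
  then show ?thesis
    using p z by (simp add: class_one_def class_comp_path_class const_in_paths)
qed

lemma class_inv_inv [simp]:
  assumes "A \<in> path_classes y z"
  shows "class_inv (class_inv A) = A"
proof -
  obtain p where p: "p \<in> paths X" "A = path_class p"
    using assms by (metis path_classesE)
  have "path_rev (path_rev p) = p"
  proof (rule paths_eqI)
    show "path_rev (path_rev p) \<in> paths X" using p by (intro path_rev_in_paths)
  qed (use p in \<open>auto simp: path_rev_def\<close>)
  with p show ?thesis by (simp add: class_inv_path_class path_rev_in_paths)
qed

lemma class_right_inv [simp]:
  assumes "A \<in> path_classes y z"
  shows "A \<cdot> class_inv A = class_one y"
proof -
  obtain p where p: "p \<in> paths X" "p 0 = y" "A = path_class p"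
    using assms by (metis path_classesE)
  then have y: "y \<in> topspace X" using path_in_topspace[of p X 0] by simp
  \<comment> \<open>Going along \<open>p\<close> and back is \<open>p\<close> run with the tent
    function, which is 0 at both ends and so can be contracted to the constant parameter 0.\<close>
  have "path_class (path_join p (path_rev p)) = path_class (\<lambda>t\<in>{0..1}. y)"
  proof (rule path_class_reparametrize[where f = p and \<phi> = "\<lambda>t. min (2 * t) (2 - 2 * t)" and \<psi> = "\<lambda>t. 0"])
    show "path_join p (path_rev p) t = p (min (2 * t) (2 - 2 * t))" if "t \<in> {0..1}" for t
      using that p by (auto simp: path_join_def path_rev_def min_def)
  qed (use p y in \<open>auto intro!: continuous_intros path_join_in_paths const_in_paths path_rev_in_paths\<close>)
  then show ?thesis
    using p y by (simp add: class_one_def class_comp_path_class class_inv_path_class path_rev_in_paths)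
qed

lemma class_left_inv [simp]:
  assumes "A \<in> path_classes y z"
  shows "class_inv A \<cdot> A = class_one z"
  using class_right_inv[OF class_inv_closed[OF assms]] assms by simp

lemma class_comp_inv_cancel [simp]:
  assumes "A \<in> path_classes y z" "B \<in> path_classes y w"
  shows "A \<cdot> (class_inv A \<cdot> B) = B"
  using assms class_comp_assoc[of A y z "class_inv A" y B w, symmetric] by simp

lemma class_inv_comp_cancel [simp]:
  assumes "A \<in> path_classes y z" "B \<in> path_classes z w"
  shows "class_inv A \<cdot> (A \<cdot> B) = B"
  using assms class_comp_assoc[of "class_inv A" z y A z B w, symmetric] by simp

lemma class_inv_comp:
  assumes A: "A \<in> path_classes y z" and B: "B \<in> path_classes z w"
  shows "class_inv (A \<cdot> B) = class_inv B \<cdot> class_inv A"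
proof -
  have "A \<cdot> B \<cdot> (class_inv B \<cdot> class_inv A) = class_one y"
    using class_comp_assoc[OF A B class_comp_closed[OF class_inv_closed[OF B] class_inv_closed[OF A]]]
      class_comp_inv_cancel[OF B class_inv_closed[OF A]] A by simp
  then have "class_inv (A \<cdot> B) \<cdot> (A \<cdot> B \<cdot> (class_inv B \<cdot> class_inv A)) = class_inv (A \<cdot> B)"
    using class_one_right[of "class_inv (A \<cdot> B)" w y] assms by auto
  then show ?thesis
    using class_inv_comp_cancel[of "A \<cdot> B" y w "class_inv B \<cdot> class_inv A" y] assms by auto
qed

text \<open>Telescoping; this is what makes \<open>spanier_cong\<close> transitive.\<close>

lemma class_comp_inv_trans:
  assumes "A \<in> path_classes y z" "B \<in> path_classes w z" "C \<in> path_classes v z"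
  shows "A \<cdot> class_inv B \<cdot> (B \<cdot> class_inv C) = A \<cdot> class_inv C"
proof -
  have "A \<cdot> class_inv B \<cdot> (B \<cdot> class_inv C) = A \<cdot> (class_inv B \<cdot> (B \<cdot> class_inv C))"
    using assms by (intro class_comp_assoc) auto
  then show ?thesis
    using class_inv_comp_cancel[OF assms(2) class_inv_closed[OF assms(3)]] by simp
qed

text \<open>The common tail \<open>C\<close> cancels, so congruence survives composition on the
  right.\<close>

lemma class_comp_inv_right:
  assumes A: "A \<in> path_classes y z" and B: "B \<in> path_classes w z" and C: "C \<in> path_classes z v"
  shows "A \<cdot> C \<cdot> class_inv (B \<cdot> C) = A \<cdot> class_inv B"
proof -
  have "A \<cdot> C \<cdot> class_inv (B \<cdot> C) = A \<cdot> C \<cdot> (class_inv C \<cdot> class_inv B)"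
    using class_inv_comp[OF B C] by simp
  also have "\<dots> = A \<cdot> (C \<cdot> (class_inv C \<cdot> class_inv B))"
    using assms by (intro class_comp_assoc) auto
  also have "\<dots> = A \<cdot> class_inv B"
    using class_comp_inv_cancel[OF C class_inv_closed[OF B]] by simp
  finally show ?thesis .
qed

text \<open>A common initial piece \<open>C\<close> conjugates the difference of \<open>A\<close>
  and \<open>B\<close>. This gives the difference the shape of a Spanier generator with connecting
  path \<open>C\<close>.\<close>

lemma class_comp_inv_left:
  assumes A: "A \<in> path_classes y z" and B: "B \<in> path_classes y z" and C: "C \<in> path_classes x y"
  shows "C \<cdot> A \<cdot> class_inv (C \<cdot> B) = C \<cdot> (A \<cdot> class_inv B) \<cdot> class_inv C"
proof -
  have B': "class_inv B \<in> path_classes z y" and C': "class_inv C \<in> path_classes y x"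
    using B C by auto
  have "C \<cdot> A \<cdot> class_inv (C \<cdot> B) = C \<cdot> A \<cdot> (class_inv B \<cdot> class_inv C)"
    using class_inv_comp[OF C B] by simp
  also have "\<dots> = C \<cdot> A \<cdot> class_inv B \<cdot> class_inv C"
    by (rule class_comp_assoc[OF class_comp_closed[OF C A] B' C', symmetric])
  also have "C \<cdot> A \<cdot> class_inv B = C \<cdot> (A \<cdot> class_inv B)"
    by (rule class_comp_assoc[OF C A B'])
  finally show ?thesis .
qed

section \<open>The fundamental group as the vertex group of the groupoid\<close>

lemma loop_class_eq_path_class:
  assumes "p \<in> loops X x"
  shows "loop_class X x p = path_class p"
proof -
  have p: "p \<in> paths X" "p 0 = x" "p 1 = x" using assms by (auto simp: loops_def)
  have "(p, q) \<in> loop_homotopy X x \<longleftrightarrow> (p, q) \<in> path_homotopy X" for q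
    using p path_homotopy_ends[of p q X] by (auto simp: loop_homotopy_def path_homotopy_def loops_def)
  then show ?thesis by (auto simp: loop_class_def path_class_def)
qed

lemma in_path_classes_imp_loop: "A \<in> path_classes x x \<Longrightarrow> p \<in> A \<Longrightarrow> p \<in> loops X x"
  by (auto simp: path_classes_def path_class_def loops_def path_homotopy_ends)
    (auto simp: path_homotopy_def)

lemma carrier_fundamental_group: "carrier (fundamental_group X x) = path_classes x x"
proof -
  have "loops X x // loop_homotopy X x = path_class ` loops X x"
    using loop_class_eq_path_class by (auto simp: quotient_def loop_class_def)
  then show ?thesis by (auto simp: fundamental_group_def path_classes_def loops_def)
qed

lemma mult_fundamental_group:
  assumes "A \<in> path_classes x x" "B \<in> path_classes x x"
  shows "A \<otimes>\<^bsub>fundamental_group X x\<^esub> B = A \<cdot> B"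
proof -
  have "loop_class X x (path_join p q) = path_class (path_join p q)" if "p \<in> A" "q \<in> B" for p q
  proof (rule loop_class_eq_path_class)
    have "p \<in> loops X x" "q \<in> loops X x" using that assms in_path_classes_imp_loop by auto
    then show "path_join p q \<in> loops X x"
      by (auto simp: loops_def intro!: path_join_in_paths)
  qed
  then show ?thesis by (simp add: fundamental_group_def class_comp_def)
qed

lemma one_fundamental_group:
  "x \<in> topspace X \<Longrightarrow> \<one>\<^bsub>fundamental_group X x\<^esub> = class_one x"
  by (simp add: fundamental_group_def class_one_def loop_class_eq_path_class loops_def const_in_paths)

text \<open>The group laws are those of the groupoid restricted to one vertex. Besides its algebraic
  use, this supplies the premise of \<open>ex1_finest_group_topology\<close>.\<close>

lemma group_fundamental_group:
  assumes "x \<in> topspace X"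
  shows "group (fundamental_group X x)"
proof (rule groupI)
  fix A assume "A \<in> carrier (fundamental_group X x)"
  then show "\<exists>B\<in>carrier (fundamental_group X x). B \<otimes>\<^bsub>fundamental_group X x\<^esub> A = \<one>\<^bsub>fundamental_group X x\<^esub>"
    using assms by (auto simp: carrier_fundamental_group mult_fundamental_group one_fundamental_group
        intro!: bexI[of _ "class_inv A"])
qed (use assms in \<open>auto simp: carrier_fundamental_group mult_fundamental_group one_fundamental_group
    class_comp_assoc[of _ x x _ x _ x]\<close>)

lemma inv_fundamental_group:
  assumes "x \<in> topspace X" "A \<in> path_classes x x"
  shows "inv\<^bsub>fundamental_group X x\<^esub> A = class_inv A"
  using assms
  by (intro group.inv_equality[OF group_fundamental_group])
    (auto simp: carrier_fundamental_group mult_fundamental_group one_fundamental_group)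

section \<open>The Spanier group of a cover\<close>

definition small_classes :: "'a set set \<Rightarrow> 'a \<Rightarrow> (real \<Rightarrow> 'a) set set" where
  "small_classes \<U> y = path_class ` {v \<in> loops X y. \<exists>U\<in>\<U>. v ` {0..1} \<subseteq> U}"

definition spanier_generators :: "'a set set \<Rightarrow> 'a \<Rightarrow> (real \<Rightarrow> 'a) set set" where
  "spanier_generators \<U> x =
     {A \<cdot> V \<cdot> class_inv A | A V y. A \<in> path_classes x y \<and> V \<in> small_classes \<U> y}"

lemma small_classes_in_path_classes: "V \<in> small_classes \<U> y \<Longrightarrow> V \<in> path_classes y y"
  by (auto simp: small_classes_def path_classes_def loops_def)

lemma spanier_generatorsI:
  "A \<in> path_classes x y \<Longrightarrow> V \<in> small_classes \<U> y \<Longrightarrow>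
    A \<cdot> V \<cdot> class_inv A \<in> spanier_generators \<U> x"
  by (auto simp: spanier_generators_def)

lemma spanier_generators_subset: "spanier_generators \<U> x \<subseteq> path_classes x x"
  using small_classes_in_path_classes by (fastforce simp: spanier_generators_def)

lemma small_classes_inv:
  assumes "V \<in> small_classes \<U> y"
  shows "class_inv V \<in> small_classes \<U> y"
proof -
  obtain v U where v: "v \<in> loops X y" "U \<in> \<U>" "v ` {0..1} \<subseteq> U" "V = path_class v"
    using assms by (auto simp: small_classes_def)
  then have "path_rev v ` {0..1} \<subseteq> U" by (auto simp: path_rev_def)
  moreover have "class_inv V = path_class (path_rev v)"
    using v by (simp add: class_inv_path_class loops_def)
  moreover have "path_rev v \<in> loops X y"
    using v by (auto simp: loops_def intro!: path_rev_in_paths)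
  ultimately show ?thesis
    using \<open>U \<in> \<U>\<close> unfolding small_classes_def by blast
qed

text \<open>Inverting \<open>u v u^-1\<close> only reverses \<open>v\<close>, which stays in the
  same member of the cover. Hence products of generators already account for inverses, as the form
  of \<open>spanier_loops\<close> demands.\<close>

lemma spanier_generators_inv:
  assumes "C \<in> spanier_generators \<U> x"
  shows "class_inv C \<in> spanier_generators \<U> x"
proof -
  obtain A V y where A: "A \<in> path_classes x y" and V: "V \<in> small_classes \<U> y"
    and C: "C = A \<cdot> V \<cdot> class_inv A"
    using assms by (auto simp: spanier_generators_def)
  note V' = small_classes_in_path_classes[OF V]
  have "class_inv C = A \<cdot> (class_inv V \<cdot> class_inv A)"
    unfolding C
    using class_inv_comp[OF class_comp_closed[OF A V'] class_inv_closed[OF A]]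
      class_inv_comp[OF A V'] A by simp
  also have "\<dots> = A \<cdot> class_inv V \<cdot> class_inv A"
    by (rule class_comp_assoc[OF A class_inv_closed[OF V'] class_inv_closed[OF A], symmetric])
  finally show ?thesis
    using spanier_generatorsI[OF A small_classes_inv[OF V]] by simp
qed

text \<open>The conjugating loop is absorbed into the connecting path:
  \<open>B (A V A^-1) B^-1 = (B A) V (B A)^-1\<close>. Normality of the generated subgroup
  follows.\<close>

lemma spanier_generators_conj:
  assumes C: "C \<in> spanier_generators \<U> x" and B: "B \<in> path_classes x x"
  shows "B \<cdot> C \<cdot> class_inv B \<in> spanier_generators \<U> x"
proof -
  obtain A V y where A: "A \<in> path_classes x y" and V: "V \<in> small_classes \<U> y"
    and C: "C = A \<cdot> V \<cdot> class_inv A"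
    using assms by (auto simp: spanier_generators_def)
  note V' = small_classes_in_path_classes[OF V]
  have "B \<cdot> C \<cdot> class_inv B = B \<cdot> (A \<cdot> V) \<cdot> class_inv (B \<cdot> A)"
    unfolding C using class_comp_inv_left[OF class_comp_closed[OF A V'] A B] by simp
  also have "B \<cdot> (A \<cdot> V) = B \<cdot> A \<cdot> V"
    by (rule class_comp_assoc[OF B A V', symmetric])
  finally show ?thesis
    using spanier_generatorsI[OF class_comp_closed[OF B A] V] by simp
qed

text \<open>Defined through \<open>generate\<close> to have the library's criterion for normality;
  agreement with \<open>spanier_group_cover\<close> is established in
  \<open>spanier_group_cover_eq\<close>.\<close>

definition spanier_subgroup :: "'a set set \<Rightarrow> 'a \<Rightarrow> (real \<Rightarrow> 'a) set set" where
  "spanier_subgroup \<U> x = generate (fundamental_group X x) (spanier_generators \<U> x)"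

lemma spanier_subgroup_normal:
  assumes "x \<in> topspace X"
  shows "spanier_subgroup \<U> x \<lhd> fundamental_group X x"
  unfolding spanier_subgroup_def
proof (rule group.normal_generateI[OF group_fundamental_group[OF assms]])
  fix C B assume "C \<in> spanier_generators \<U> x" "B \<in> carrier (fundamental_group X x)"
  then show "B \<otimes>\<^bsub>fundamental_group X x\<^esub> C \<otimes>\<^bsub>fundamental_group X x\<^esub> inv\<^bsub>fundamental_group X x\<^esub> B
      \<in> spanier_generators \<U> x"
    using spanier_generators_subset[of \<U> x] assms spanier_generators_conj[of C \<U> x B]
    by (auto simp: carrier_fundamental_group inv_fundamental_group subset_iff mult_fundamental_group)
qed (simp add: carrier_fundamental_group spanier_generators_subset)

lemma spanier_subgroup_subset: "x \<in> topspace X \<Longrightarrow> spanier_subgroup \<U> x \<subseteq> path_classes x x"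
  using normal_imp_subgroup[OF spanier_subgroup_normal] subgroup.subset
  by (fastforce simp: carrier_fundamental_group)

lemma spanier_subgroup_comp:
  assumes "x \<in> topspace X" "A \<in> spanier_subgroup \<U> x" "B \<in> spanier_subgroup \<U> x"
  shows "A \<cdot> B \<in> spanier_subgroup \<U> x"
  using subgroup.m_closed[OF normal_imp_subgroup[OF spanier_subgroup_normal[OF assms(1)]] assms(2,3)]
    spanier_subgroup_subset[OF assms(1)] assms(2,3)
  by (simp add: mult_fundamental_group subset_iff)

section \<open>Agreement of the generated subgroup with the classes of
  \<open>spanier_loops\<close>\<close>

lemma spanier_loop_class:
  assumes "u \<in> paths X" "v \<in> loops X (u 1)"
  shows "path_join (path_join u v) (path_rev u) \<in> loops X (u 0)"
    "path_class (path_join (path_join u v) (path_rev u)) =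
      path_class u \<cdot> path_class v \<cdot> class_inv (path_class u)"
  using assms
  by (simp_all add: loops_def class_comp_path_class class_inv_path_class path_join_in_paths
      path_rev_in_paths)

lemma spanier_loops_class:
  assumes "p \<in> spanier_loops X \<U> x" and x: "x \<in> topspace X"
  shows "p \<in> loops X x \<and> path_class p \<in> spanier_subgroup \<U> x"
  using assms(1)
proof induction
  case (single u v U)
  then have "path_class u \<in> path_classes x (u 1)" "path_class v \<in> small_classes \<U> (u 1)"
    by (auto simp: small_classes_def path_classes_def)
  from spanier_generatorsI[OF this] show ?case
    unfolding spanier_subgroup_def using spanier_loop_class[of u v] single
    by (auto intro: generate.incl)
next
  case (step p u v U)
  let ?w = "path_join (path_join u v) (path_rev u)"
  from step have "path_class u \<in> path_classes x (u 1)" "path_class v \<in> small_classes \<U> (u 1)"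
    by (auto simp: small_classes_def path_classes_def)
  from spanier_generatorsI[OF this] have "path_class ?w \<in> spanier_subgroup \<U> x"
    unfolding spanier_subgroup_def using spanier_loop_class[of u v] step
    by (auto intro: generate.incl)
  moreover have "?w \<in> loops X x" using spanier_loop_class[of u v] step by simp
  ultimately show ?case
    using step.IH spanier_subgroup_comp[OF x, of "path_class p" \<U> "path_class ?w"]
    by (auto simp: loops_def class_comp_path_class intro!: path_join_in_paths)
qed

text \<open>Induction over \<open>generate\<close>: the unit, the inverses of generators and the
  generators themselves are single factors, and products are obtained by appending the factors of
  the second loop to the first.\<close>

lemma spanier_subgroup_loop:
  assumes "C \<in> spanier_subgroup \<U> x" and x: "x \<in> topspace X" and \<U>: "open_cover X \<U>"
  shows "\<exists>p\<in>spanier_loops X \<U> x. C = path_class p"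
proof -
  have gen: "\<exists>p\<in>spanier_loops X \<U> x. C = path_class p" if "C \<in> spanier_generators \<U> x" for C
  proof -
    obtain u v U where "u \<in> paths X" "u 0 = x" "v \<in> loops X (u 1)" "U \<in> \<U>" "v ` {0..1} \<subseteq> U"
      and "C = path_class u \<cdot> path_class v \<cdot> class_inv (path_class u)"
    proof -
      obtain A V y where A: "A \<in> path_classes x y" "V \<in> small_classes \<U> y"
        "C = A \<cdot> V \<cdot> class_inv A"
        using \<open>C \<in> spanier_generators \<U> x\<close> by (auto simp: spanier_generators_def)
      obtain u where u: "u \<in> paths X" "u 0 = x" "u 1 = y" "A = path_class u"
        using path_classesE[OF A(1)] .
      obtain v U where "v \<in> loops X y" "U \<in> \<U>" "v ` {0..1} \<subseteq> U" "V = path_class v"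
        using A(2) by (auto simp: small_classes_def)
      with u A(3) show thesis by (intro that) auto
    qed
    then show ?thesis
      using spanier_loop_class[of u v] by (auto intro!: bexI[OF _ spanier_loops.single])
  qed
  show ?thesis
    using assms(1) unfolding spanier_subgroup_def
  proof induction
    case one
    \<comment> \<open>There is no empty product in \<open>spanier_loops\<close>. The unit is written
      as a generator with constant connecting path and constant small loop, and for the latter some
      member of the cover must contain \<open>x\<close>.\<close>
    obtain U where "U \<in> \<U>" "x \<in> U" using x \<U> by (auto simp: open_cover_def)
    then have "class_one x \<in> small_classes \<U> x"
      using x by (auto simp: small_classes_def class_one_def loops_def
          intro!: imageI bexI[of _ U] const_in_paths)
    from spanier_generatorsI[OF class_one_closed[OF x] this]
    have "class_one x \<in> spanier_generators \<U> x"
      using class_one_right[OF class_one_closed[OF x]] class_right_inv[OF class_one_closed[OF x]]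
      by simp
    then show ?case using gen x by (simp add: one_fundamental_group)
  next
    case (inv h)
    then show ?case
      using gen[OF spanier_generators_inv[OF inv]]
        inv_fundamental_group[OF x subsetD[OF spanier_generators_subset inv]] by simp
  next
    case (eng C D)
    then obtain p q where p: "p \<in> spanier_loops X \<U> x" "C = path_class p"
      and q: "q \<in> spanier_loops X \<U> x" "D = path_class q" by auto
    note p' = spanier_loops_class[OF p(1) x, THEN conjunct1]
    \<comment> \<open>\<open>spanier_loops\<close> grows by one factor on the right, so the second
      loop is taken apart by induction and its factors are moved to \<open>p\<close> one at a time.
      Reassociation changes the loop but not its class, which is why only the existence of some
      \<open>r\<close> is claimed.\<close>
    have "\<exists>r\<in>spanier_loops X \<U> x. path_class p \<cdot> path_class q = path_class r"
      using q(1)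
    proof induction
      case (single u v U)
      then show ?case
        using spanier_loops.step[OF p(1) single] p' spanier_loop_class(1)[of u v]
        by (intro bexI[of _ "path_join p (path_join (path_join u v) (path_rev u))"])
          (auto simp: class_comp_path_class loops_def)
    next
      case (step q u v U)
      let ?w = "path_join (path_join u v) (path_rev u)"
      obtain r where r: "r \<in> spanier_loops X \<U> x" "path_class p \<cdot> path_class q = path_class r"
        using step by auto
      have q': "q \<in> loops X x" and r': "r \<in> loops X x"
        using spanier_loops_class[OF _ x] step r by auto
      have w': "?w \<in> loops X x" using spanier_loop_class(1)[of u v] step by simp
      have "path_class p \<cdot> path_class (path_join q ?w) = path_class p \<cdot> (path_class q \<cdot> path_class ?w)"
        using q' w' by (simp add: class_comp_path_class loops_def)
      also have "\<dots> = path_class p \<cdot> path_class q \<cdot> path_class ?w"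
        using p' q' w'
        by (intro class_comp_assoc[of _ x x _ x _ x, symmetric]) (auto simp: loops_def path_classes_def)
      also have "\<dots> = path_class (path_join r ?w)"
        unfolding r(2) using r' w' by (simp add: class_comp_path_class loops_def)
      finally show ?case
        using spanier_loops.step[OF r(1) step(2-6)] by auto
    qed
    moreover have "C \<in> path_classes x x" "D \<in> path_classes x x"
      using p q spanier_loops_class[OF _ x] spanier_subgroup_subset[OF x] by blast+
    ultimately show ?case
      using p q by (simp add: mult_fundamental_group)
  qed (use gen in auto)
qed

lemma spanier_group_cover_eq:
  assumes x: "x \<in> topspace X" and "open_cover X \<U>"
  shows "spanier_group_cover X \<U> x = spanier_subgroup \<U> x"
proof
  show "spanier_group_cover X \<U> x \<subseteq> spanier_subgroup \<U> x"
  proof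
    fix C assume "C \<in> spanier_group_cover X \<U> x"
    then obtain p where "C \<in> path_classes x x" "p \<in> C" "p \<in> spanier_loops X \<U> x"
      by (auto simp: spanier_group_cover_def carrier_fundamental_group)
    then show "C \<in> spanier_subgroup \<U> x"
      using spanier_loops_class[OF _ x] path_class_eq[OF in_path_class]
      by (fastforce elim!: path_classesE)
  qed
  show "spanier_subgroup \<U> x \<subseteq> spanier_group_cover X \<U> x"
  proof
    fix C assume C: "C \<in> spanier_subgroup \<U> x"
    obtain p where p: "p \<in> spanier_loops X \<U> x" "C = path_class p"
      using spanier_subgroup_loop[OF C assms] by auto
    moreover have "p \<in> paths X" using spanier_loops_class[OF p(1) x] by (simp add: loops_def)
    ultimately show "C \<in> spanier_group_cover X \<U> x"
      using C spanier_subgroup_subset[OF x] path_class_self[of p]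
      by (auto simp: spanier_group_cover_def carrier_fundamental_group)
  qed
qed

text \<open>Equality modulo the Spanier subgroup for classes of paths that start at \<open>y\<close>
  and not at \<open>x\<close>: the difference is transported to \<open>x\<close> along
  \<open>C\<close>. Asking for every \<open>C\<close> makes the relation stable under composition on
  the left.\<close>

definition spanier_cong ::
    "'a set set \<Rightarrow> 'a \<Rightarrow> 'a \<Rightarrow> (real \<Rightarrow> 'a) set \<Rightarrow> (real \<Rightarrow> 'a) set \<Rightarrow> bool" where
  "spanier_cong \<U> x y A B \<longleftrightarrow>
     (\<forall>C\<in>path_classes x y. C \<cdot> A \<cdot> class_inv (C \<cdot> B) \<in> spanier_subgroup \<U> x)"

lemma spanier_cong_trans:
  assumes x: "x \<in> topspace X"
    and ABD: "A \<in> path_classes y z" "B \<in> path_classes y z" "D \<in> path_classes y z"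
    and AB: "spanier_cong \<U> x y A B" and BD: "spanier_cong \<U> x y B D"
  shows "spanier_cong \<U> x y A D"
  unfolding spanier_cong_def
proof
  fix C assume C: "C \<in> path_classes x y"
  have "C \<cdot> A \<cdot> class_inv (C \<cdot> B) \<cdot> (C \<cdot> B \<cdot> class_inv (C \<cdot> D)) \<in> spanier_subgroup \<U> x"
    using spanier_subgroup_comp[OF x] AB BD C by (simp add: spanier_cong_def)
  then show "C \<cdot> A \<cdot> class_inv (C \<cdot> D) \<in> spanier_subgroup \<U> x"
    using class_comp_inv_trans[OF class_comp_closed[OF C ABD(1)] class_comp_closed[OF C ABD(2)]
        class_comp_closed[OF C ABD(3)]] by simp
qed

text \<open>The quantifier over \<open>C\<close> in the hypothesis is instantiated with
  \<open>C \<cdot> D\<close>.\<close>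

lemma spanier_cong_left:
  assumes D: "D \<in> path_classes w y" and A: "A \<in> path_classes y z" and B: "B \<in> path_classes y z"
    and AB: "spanier_cong \<U> x y A B"
  shows "spanier_cong \<U> x w (D \<cdot> A) (D \<cdot> B)"
  unfolding spanier_cong_def
proof
  fix C assume C: "C \<in> path_classes x w"
  show "C \<cdot> (D \<cdot> A) \<cdot> class_inv (C \<cdot> (D \<cdot> B)) \<in> spanier_subgroup \<U> x"
    using AB C D class_comp_assoc[OF C D A] class_comp_assoc[OF C D B] class_comp_closed[OF C D]
    by (metis spanier_cong_def)
qed

lemma spanier_cong_right:
  assumes A: "A \<in> path_classes y z" and B: "B \<in> path_classes y z" and D: "D \<in> path_classes z w"
    and AB: "spanier_cong \<U> x y A B"
  shows "spanier_cong \<U> x y (A \<cdot> D) (B \<cdot> D)"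
  unfolding spanier_cong_def
proof
  fix C assume C: "C \<in> path_classes x y"
  show "C \<cdot> (A \<cdot> D) \<cdot> class_inv (C \<cdot> (B \<cdot> D)) \<in> spanier_subgroup \<U> x"
    using AB C class_comp_assoc[OF C A D] class_comp_assoc[OF C B D]
      class_comp_inv_right[OF class_comp_closed[OF C A] class_comp_closed[OF C B] D]
    by (metis spanier_cong_def)
qed

text \<open>The loop \<open>p\<close> followed by the reverse of \<open>q\<close> lies in
  \<open>U\<close>, so preceding it by \<open>C\<close> and returning along \<open>C\<close> gives a
  generator. This is the only place where smallness is turned into membership in the
  subgroup.\<close>

lemma spanier_cong_small:
  assumes p: "p \<in> paths X" "p ` {0..1} \<subseteq> U" and q: "q \<in> paths X" "q ` {0..1} \<subseteq> U"
    and ends: "p 0 = q 0" "p 1 = q 1" and U: "U \<in> \<U>"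
  shows "spanier_cong \<U> x (p 0) (path_class p) (path_class q)"
  unfolding spanier_cong_def
proof
  fix C assume C: "C \<in> path_classes x (p 0)"
  let ?v = "path_join p (path_rev q)"
  have "?v ` {0..1} \<subseteq> U"
    using p(2) q(2) by (auto simp: path_join_def path_rev_def image_subset_iff)
  moreover have "?v \<in> loops X (p 0)"
    using p q ends by (auto simp: loops_def intro!: path_join_in_paths path_rev_in_paths)
  ultimately have "path_class ?v \<in> small_classes \<U> (p 0)"
    using U by (auto simp: small_classes_def)
  moreover have "path_class ?v = path_class p \<cdot> class_inv (path_class q)"
    using p q ends by (simp add: class_comp_path_class class_inv_path_class path_rev_in_paths)
  ultimately have "C \<cdot> (path_class p \<cdot> class_inv (path_class q)) \<cdot> class_inv C
      \<in> spanier_generators \<U> x"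
    using spanier_generatorsI[OF C] by simp
  then show "C \<cdot> path_class p \<cdot> class_inv (C \<cdot> path_class q) \<in> spanier_subgroup \<U> x"
    using class_comp_inv_left[OF _ _ C, of "path_class p" "p 1" "path_class q"] p q ends
    by (auto simp: spanier_subgroup_def path_class_in_path_classes intro: generate.incl)
qed

section \<open>Loops close to a given loop\<close>

definition subpath_on :: "(real \<Rightarrow> 'a) \<Rightarrow> real \<Rightarrow> real \<Rightarrow> real \<Rightarrow> 'a" where
  "subpath_on p a b = (\<lambda>t\<in>{0..1}. p (a + t * (b - a)))"

lemma affine_in_interval:
  fixes a b t :: real
  assumes "t \<in> {0..1}" "a \<le> b"
  shows "a + t * (b - a) \<in> {a..b}"
proof -
  have "0 \<le> t * (b - a)" "t * (b - a) \<le> b - a"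
    using assms by (auto intro!: mult_left_le_one_le)
  then show ?thesis by simp
qed

lemma subpath_on_in_paths:
  assumes "p \<in> paths X" "0 \<le> a" "a \<le> b" "b \<le> 1"
  shows "subpath_on p a b \<in> paths X"
  unfolding subpath_on_def
proof (rule restrict_in_paths)
  have "continuous_map unit_interval unit_interval (\<lambda>t. a + t * (b - a))"
    using affine_in_interval[of _ a b] assms
    by (fastforce simp: continuous_map_subtopology_eu intro!: continuous_intros)
  from continuous_map_compose[OF this, of X p]
  show "continuous_map unit_interval X (\<lambda>t. p (a + t * (b - a)))"
    using assms by (simp add: o_def cont_maps_def)
qed

lemma subpath_on_ends [simp]: "subpath_on p a b 0 = p a" "subpath_on p a b 1 = p b"
  by (auto simp: subpath_on_def)

lemma subpath_on_image: "a \<le> b \<Longrightarrow> p ` {a..b} \<subseteq> U \<Longrightarrow> subpath_on p a b ` {0..1} \<subseteq> U"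
  using affine_in_interval[of _ a b] by (auto simp: subpath_on_def)

lemma subpath_on_full: "p \<in> paths X \<Longrightarrow> subpath_on p 0 1 = p"
  using subpath_on_in_paths[of p 0 1] by (intro paths_eqI[where X = X]) (auto simp: subpath_on_def)

lemma subpath_on_join:
  assumes p: "p \<in> paths X" and abc: "0 \<le> a" "a \<le> b" "b \<le> c" "c \<le> 1"
  shows "path_class (subpath_on p a b) \<cdot> path_class (subpath_on p b c) = path_class (subpath_on p a c)"
proof -
  have sub: "subpath_on p a b \<in> paths X" "subpath_on p b c \<in> paths X" "subpath_on p a c \<in> paths X"
    using assms by (auto intro!: subpath_on_in_paths)
  \<comment> \<open>Both sides are \<open>p\<close> run with different parameters. In
    \<open>\<phi>\<close> the clamped terms act one after the other: the first moves from
    \<open>a\<close> to \<open>b\<close> while \<open>t \<le> 1/2\<close>, the second from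
    \<open>b\<close> to \<open>c\<close> afterwards.\<close>
  have "path_class (path_join (subpath_on p a b) (subpath_on p b c)) = path_class (subpath_on p a c)"
  proof (rule path_class_reparametrize[where f = p
        and \<phi> = "\<lambda>t. a + min 1 (2 * t) * (b - a) + max 0 (2 * t - 1) * (c - b)"
        and \<psi> = "\<lambda>t. a + t * (c - a)"])
    show "(\<lambda>t. a + min 1 (2 * t) * (b - a) + max 0 (2 * t - 1) * (c - b)) \<in> {0..1} \<rightarrow> {0..1}"
    proof
      fix t :: real assume "t \<in> {0..1}"
      then have "a + min 1 (2 * t) * (b - a) \<in> {a..b}" "b + max 0 (2 * t - 1) * (c - b) \<in> {b..c}"
        using abc by (intro affine_in_interval; auto)+
      then show "a + min 1 (2 * t) * (b - a) + max 0 (2 * t - 1) * (c - b) \<in> {0..1}"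
        using abc by auto
    qed
    show "(\<lambda>t. a + t * (c - a)) \<in> {0..1} \<rightarrow> {0..1}"
      using affine_in_interval[of _ a c] abc by fastforce
    fix t :: real assume t: "t \<in> {0..1}"
    show "subpath_on p a c t = p (a + t * (c - a))" using t by (simp add: subpath_on_def)
    show "path_join (subpath_on p a b) (subpath_on p b c) t
        = p (a + min 1 (2 * t) * (b - a) + max 0 (2 * t - 1) * (c - b))"
    proof (cases "t \<le> 1/2")
      case True
      then have "min 1 (2 * t) = 2 * t" "max 0 (2 * t - 1) = 0" by auto
      then show ?thesis using True t by (simp add: path_join_def subpath_on_def)
    next
      case False
      then have "min 1 (2 * t) = 1" "max 0 (2 * t - 1) = 2 * t - 1" by auto
      then show ?thesis using False t by (simp add: path_join_def subpath_on_def)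
    qed
  qed (use p sub in \<open>auto intro!: path_join_in_paths continuous_intros\<close>)
  then show ?thesis using sub by (simp add: class_comp_path_class)
qed

lemma openin_compact_open:
  "compact K \<Longrightarrow> K \<subseteq> {0..1} \<Longrightarrow> openin X U \<Longrightarrow>
    openin (compact_open_topology unit_interval X) {f \<in> paths X. f ` K \<subseteq> U}"
  unfolding compact_open_topology_def
  by (rule topology_generated_by_Basis) (auto simp: compactin_subtopology)

text \<open>A short path \<open>c\<close> from \<open>p a\<close> to \<open>q a\<close> is moved along \<open>p\<close> and \<open>q\<close> to a short path \<open>d\<close> from
  \<open>p b\<close> to \<open>q b\<close>, the resulting square commuting modulo the Spanier subgroup.\<close>

definition transports ::
    "'a set set \<Rightarrow> 'a \<Rightarrow> real \<Rightarrow> real \<Rightarrow> 'a set \<Rightarrow> 'a set \<Rightarrow> (real \<Rightarrow> 'a) \<Rightarrow> (real \<Rightarrow> 'a) \<Rightarrow> bool" where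
  "transports \<U> x a b V\<^sub>a V\<^sub>b p q \<longleftrightarrow>
     (\<forall>c\<in>paths X. c ` {0..1} \<subseteq> V\<^sub>a \<and> c 0 = p a \<and> c 1 = q a \<longrightarrow>
       (\<exists>d\<in>paths X. d ` {0..1} \<subseteq> V\<^sub>b \<and> d 0 = p b \<and> d 1 = q b \<and>
         spanier_cong \<U> x (p a) (path_class (subpath_on p a b) \<cdot> path_class d)
           (path_class c \<cdot> path_class (subpath_on q a b))))"

text \<open>The set \<open>V\<^sub>a\<close> is chosen before \<open>V\<^sub>b\<close>, so that intervals can be concatenated.\<close>

definition comparable_on :: "'a set set \<Rightarrow> 'a \<Rightarrow> (real \<Rightarrow> 'a) \<Rightarrow> real \<Rightarrow> real \<Rightarrow> bool" where
  "comparable_on \<U> x p a b \<longleftrightarrow>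
     (\<exists>V\<^sub>a. openin X V\<^sub>a \<and> p a \<in> V\<^sub>a \<and> (\<forall>V\<^sub>b. openin X V\<^sub>b \<and> p b \<in> V\<^sub>b \<longrightarrow>
       (\<exists>W. openin (compact_open_topology unit_interval X) W \<and> p \<in> W \<and>
         (\<forall>q\<in>W. transports \<U> x a b V\<^sub>a V\<^sub>b p q))))"

lemma transportsD:
  assumes "transports \<U> x a b Va Vb p q"
    and "c \<in> paths X" "c ` {0..1} \<subseteq> Va" "c 0 = p a" "c 1 = q a"
  obtains d where "d \<in> paths X" "d ` {0..1} \<subseteq> Vb" "d 0 = p b" "d 1 = q b"
    "spanier_cong \<U> x (p a) (path_class (subpath_on p a b) \<cdot> path_class d)
      (path_class c \<cdot> path_class (subpath_on q a b))"
  using assms unfolding transports_def by blast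

text \<open>Two squares are pasted along the short path \<open>d\<close> over \<open>b\<close>.
  Writing \<open>p1, p2\<close> and \<open>q1, q2\<close> for the two pieces of \<open>p\<close> and
  \<open>q\<close>, the chain is
  \<open>p1 (p2 f) ~ p1 (d q2) = (p1 d) q2 ~ (c q1) q2\<close>.\<close>

lemma transports_trans:
  assumes x: "x \<in> topspace X" and p: "p \<in> paths X" and q: "q \<in> paths X"
    and abe: "0 \<le> a" "a \<le> b" "b \<le> e" "e \<le> 1"
    and ab: "transports \<U> x a b Va Vb p q" and be: "transports \<U> x b e Vb Ve p q"
  shows "transports \<U> x a e Va Ve p q"
  unfolding transports_def
proof (intro ballI impI)
  fix c assume c: "c \<in> paths X" "c ` {0..1} \<subseteq> Va \<and> c 0 = p a \<and> c 1 = q a"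
  obtain d where d: "d \<in> paths X" "d ` {0..1} \<subseteq> Vb" "d 0 = p b" "d 1 = q b"
    and cong_ab: "spanier_cong \<U> x (p a) (path_class (subpath_on p a b) \<cdot> path_class d)
      (path_class c \<cdot> path_class (subpath_on q a b))"
    using transportsD[OF ab c(1)] c(2) by blast
  obtain f where f: "f \<in> paths X" "f ` {0..1} \<subseteq> Ve" "f 0 = p e" "f 1 = q e"
    and cong_be: "spanier_cong \<U> x (p b) (path_class (subpath_on p b e) \<cdot> path_class f)
      (path_class d \<cdot> path_class (subpath_on q b e))"
    using transportsD[OF be d] by blast
  have classes: "path_class (subpath_on p a b) \<in> path_classes (p a) (p b)"
    "path_class (subpath_on p b e) \<in> path_classes (p b) (p e)"
    "path_class (subpath_on q a b) \<in> path_classes (q a) (q b)"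
    "path_class (subpath_on q b e) \<in> path_classes (q b) (q e)"
    "path_class c \<in> path_classes (p a) (q a)"
    "path_class d \<in> path_classes (p b) (q b)"
    "path_class f \<in> path_classes (p e) (q e)"
    using p q c d f abe by (auto intro!: path_class_in_path_classes subpath_on_in_paths)
  note closed = class_comp_closed[OF classes(1) class_comp_closed[OF classes(2,7)]]
    class_comp_closed[OF classes(1) class_comp_closed[OF classes(6,4)]]
    class_comp_closed[OF class_comp_closed[OF classes(5,3)] classes(4)]
  have "spanier_cong \<U> x (p a)
      (path_class (subpath_on p a b) \<cdot> (path_class (subpath_on p b e) \<cdot> path_class f))
      (path_class (subpath_on p a b) \<cdot> (path_class d \<cdot> path_class (subpath_on q b e)))"
    by (rule spanier_cong_left[OF classes(1) _ _ cong_be]) (use classes in auto)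
  moreover have "spanier_cong \<U> x (p a)
      (path_class (subpath_on p a b) \<cdot> path_class d \<cdot> path_class (subpath_on q b e))
      (path_class c \<cdot> path_class (subpath_on q a b) \<cdot> path_class (subpath_on q b e))"
    by (rule spanier_cong_right[OF _ _ _ cong_ab]) (use classes in auto)
  ultimately have "spanier_cong \<U> x (p a)
      (path_class (subpath_on p a b) \<cdot> (path_class (subpath_on p b e) \<cdot> path_class f))
      (path_class c \<cdot> path_class (subpath_on q a b) \<cdot> path_class (subpath_on q b e))"
    using spanier_cong_trans[OF x closed] class_comp_assoc[OF classes(1,6,4)] by simp
  then have "spanier_cong \<U> x (p a) (path_class (subpath_on p a e) \<cdot> path_class f)
      (path_class c \<cdot> path_class (subpath_on q a e))"
    using class_comp_assoc[OF classes(1,2,7)] class_comp_assoc[OF classes(5,3,4)]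
      subpath_on_join[OF p abe] subpath_on_join[OF q abe] by simp
  with f show "\<exists>d\<in>paths X. d ` {0..1} \<subseteq> Ve \<and> d 0 = p e \<and> d 1 = q e \<and>
      spanier_cong \<U> x (p a) (path_class (subpath_on p a e) \<cdot> path_class d)
        (path_class c \<cdot> path_class (subpath_on q a e))" by blast
qed

lemma comparable_onE:
  assumes "comparable_on \<U> x p a b"
  obtains Va where "openin X Va" "p a \<in> Va"
    "\<And>Vb. openin X Vb \<Longrightarrow> p b \<in> Vb \<Longrightarrow>
      \<exists>W. openin (compact_open_topology unit_interval X) W \<and> p \<in> W \<and>
        (\<forall>q\<in>W. transports \<U> x a b Va Vb p q)"
  using assms unfolding comparable_on_def by blast

text \<open>The second interval is opened first: the neighbourhood \<open>Vb\<close> that it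
  prescribes at \<open>b\<close> serves as the target for the first interval. Only then is
  \<open>Ve\<close> given, and the two neighbourhoods of \<open>p\<close> are intersected.\<close>

lemma comparable_on_trans:
  assumes x: "x \<in> topspace X" and p: "p \<in> paths X" and abe: "0 \<le> a" "a \<le> b" "b \<le> e" "e \<le> 1"
    and ab: "comparable_on \<U> x p a b" and be: "comparable_on \<U> x p b e"
  shows "comparable_on \<U> x p a e"
proof -
  let ?T = "compact_open_topology unit_interval X"
  obtain Vb where Vb: "openin X Vb" "p b \<in> Vb" and be': "\<And>Ve. openin X Ve \<Longrightarrow> p e \<in> Ve \<Longrightarrow>
      \<exists>W. openin ?T W \<and> p \<in> W \<and> (\<forall>q\<in>W. transports \<U> x b e Vb Ve p q)"
    by (rule comparable_onE[OF be]) (rule that; blast)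
  obtain Va where Va: "openin X Va" "p a \<in> Va" and ab': "\<And>Vb. openin X Vb \<Longrightarrow> p b \<in> Vb \<Longrightarrow>
      \<exists>W. openin ?T W \<and> p \<in> W \<and> (\<forall>q\<in>W. transports \<U> x a b Va Vb p q)"
    by (rule comparable_onE[OF ab]) (rule that; blast)
  obtain W where W: "openin ?T W" "p \<in> W" and Wab: "\<And>q. q \<in> W \<Longrightarrow> transports \<U> x a b Va Vb p q"
    using ab'[OF Vb] by blast
  have "\<exists>W. openin ?T W \<and> p \<in> W \<and> (\<forall>q\<in>W. transports \<U> x a e Va Ve p q)"
    if Ve: "openin X Ve" "p e \<in> Ve" for Ve
  proof -
    obtain W' where W': "openin ?T W'" "p \<in> W'"
      and Wbe: "\<And>q. q \<in> W' \<Longrightarrow> transports \<U> x b e Vb Ve p q"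
      using be'[OF Ve] by blast
    have "transports \<U> x a e Va Ve p q" if "q \<in> W \<inter> W'" for q
      using that openin_subset[OF W(1)] Wab Wbe
      by (intro transports_trans[OF x p _ abe, of q \<U> Va Vb Ve]) auto
    then show ?thesis
      using W W' by (intro exI[of _ "W \<inter> W'"] conjI openin_Int) auto
  qed
  then show ?thesis
    using Va unfolding comparable_on_def by blast
qed

text \<open>All four sides of the square lie in the single cover member \<open>U\<close>, so it
  commutes modulo the Spanier subgroup by \<open>spanier_cong_small\<close>. Accordingly
  \<open>U\<close> itself serves as the neighbourhood at \<open>a\<close>.\<close>

lemma comparable_on_small:
  assumes X: "locally_path_connected_space X" and U: "openin X U" "U \<in> \<U>"
    and p: "p \<in> paths X" "p ` {a..b} \<subseteq> U" and ab: "0 \<le> a" "a \<le> b" "b \<le> 1"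
  shows "comparable_on \<U> x p a b"
  unfolding comparable_on_def
proof (rule exI[of _ U], intro conjI allI impI U)
  show "p a \<in> U" using p ab by auto
  fix Vb assume Vb: "openin X Vb \<and> p b \<in> Vb"
  then have "openin X (Vb \<inter> U)" "p b \<in> Vb \<inter> U" using U p ab by auto
  \<comment> \<open>Local path connectedness enters here: once \<open>q b\<close> is forced into
    \<open>V\<close>, the path \<open>d\<close> can be drawn inside \<open>V\<close>, hence both in
    the prescribed \<open>Vb\<close> and in \<open>U\<close>.\<close>
  then obtain V where V: "openin X V" "path_connectedin X V" "p b \<in> V" "V \<subseteq> Vb \<inter> U"
    using X unfolding locally_path_connected_space by meson
  let ?W = "{f \<in> paths X. f ` {a..b} \<subseteq> U} \<inter> {f \<in> paths X. f ` {b} \<subseteq> V}"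
  show "\<exists>W. openin (compact_open_topology unit_interval X) W \<and> p \<in> W \<and>
      (\<forall>q\<in>W. transports \<U> x a b U Vb p q)"
    unfolding transports_def
  proof (rule exI[of _ ?W], intro conjI ballI impI)
    show "openin (compact_open_topology unit_interval X) ?W"
      using ab U V by (intro openin_Int openin_compact_open) auto
    show "p \<in> ?W" using p V by auto
    fix q c assume q: "q \<in> ?W" and c: "c \<in> paths X" "c ` {0..1} \<subseteq> U \<and> c 0 = p a \<and> c 1 = q a"
    have "q b \<in> V" using q by auto
    then obtain g where g: "pathin X g" "g \<in> {0..1} \<rightarrow> V" "g 0 = p b" "g 1 = q b"
      using V unfolding path_connectedin by meson
    define d where "d = restrict g {0..1}"
    have d: "d \<in> paths X" "d ` {0..1} \<subseteq> V" "d 0 = p b" "d 1 = q b"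
      using g by (auto simp: d_def pathin_def intro!: restrict_in_paths)
    have sub: "subpath_on p a b \<in> paths X" "subpath_on q a b \<in> paths X"
      using p q ab by (auto intro!: subpath_on_in_paths)
    have "subpath_on p a b ` {0..1} \<subseteq> U" "subpath_on q a b ` {0..1} \<subseteq> U"
      using subpath_on_image[of a b p U] subpath_on_image[of a b q U] p q ab by auto
    moreover have "d ` {0..1} \<subseteq> U" using d V by auto
    ultimately have "path_join (subpath_on p a b) d ` {0..1} \<subseteq> U"
      "path_join c (subpath_on q a b) ` {0..1} \<subseteq> U"
      using c by (auto simp: path_join_def image_subset_iff)
    then have "spanier_cong \<U> x (path_join (subpath_on p a b) d 0)
        (path_class (path_join (subpath_on p a b) d)) (path_class (path_join c (subpath_on q a b)))"
      using U c d sub by (intro spanier_cong_small) (auto intro!: path_join_in_paths)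
    then have "spanier_cong \<U> x (p a) (path_class (subpath_on p a b) \<cdot> path_class d)
               (path_class c \<cdot> path_class (subpath_on q a b))"
      using c d sub by (simp add: class_comp_path_class)
    then show "\<exists>d\<in>paths X. d ` {0..1} \<subseteq> Vb \<and> d 0 = p b \<and> d 1 = q b \<and>
             spanier_cong \<U> x (p a) (path_class (subpath_on p a b) \<cdot> path_class d)
               (path_class c \<cdot> path_class (subpath_on q a b))"
      using d V by blast
  qed
qed

lemma comparable_on_unit_interval:
  assumes X: "locally_path_connected_space X" and \<U>: "open_cover X \<U>"
    and x: "x \<in> topspace X" and p: "p \<in> paths X"
  shows "comparable_on \<U> x p 0 1"
proof -
  have "0 \<le> (0::real) \<and> 1 \<le> (1::real) \<longrightarrow> comparable_on \<U> x p 0 1"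
  \<comment> \<open>The local condition of \<open>Bolzano\<close> ranges over all short intervals
    around \<open>t\<close>, including those that leave the unit interval; the guard
    \<open>0 \<le> a \<and> b \<le> 1\<close> makes the claim vacuous for them.\<close>
  proof (rule Bolzano[where P = "\<lambda>a b. 0 \<le> a \<and> b \<le> 1 \<longrightarrow> comparable_on \<U> x p a b"])
    fix t :: real assume t: "0 \<le> t" "t \<le> 1"
    then have "p t \<in> topspace X" using path_in_topspace[OF p] by simp
    then obtain U where U: "U \<in> \<U>" "openin X U" "p t \<in> U"
      using \<U> by (auto simp: open_cover_def)
    then have "openin unit_interval {s \<in> {0..1}. p s \<in> U}"
      using p openin_continuous_map_preimage[of unit_interval X p U] by (simp add: cont_maps_def)
    moreover have "t \<in> {s \<in> {0..1}. p s \<in> U}" using t U by simp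
    ultimately obtain \<delta> where "\<delta> > 0"
      "\<forall>s\<in>{0..1}. dist s t < \<delta> \<longrightarrow> s \<in> {s \<in> {0..1}. p s \<in> U}"
      unfolding openin_euclidean_subtopology_iff by meson
    then have \<delta>: "\<delta> > 0" "\<And>s. s \<in> {0..1} \<Longrightarrow> dist s t < \<delta> \<Longrightarrow> p s \<in> U"
      by auto
    have "comparable_on \<U> x p a b" if "a \<le> t" "t \<le> b" "b - a < \<delta>" "0 \<le> a" "b \<le> 1" for a b
    proof (rule comparable_on_small[OF X U(2,1) p])
      show "p ` {a..b} \<subseteq> U" using \<delta>(2) that by (auto simp: dist_real_def)
    qed (use that in auto)
    then show "\<exists>\<delta>>0. \<forall>a b. a \<le> t \<and> t \<le> b \<and> b - a < \<delta> \<longrightarrow>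
        0 \<le> a \<and> b \<le> 1 \<longrightarrow> comparable_on \<U> x p a b"
      using \<delta>(1) by blast
  next
    fix a b c assume "0 \<le> a \<and> b \<le> 1 \<longrightarrow> comparable_on \<U> x p a b"
      "0 \<le> b \<and> c \<le> 1 \<longrightarrow> comparable_on \<U> x p b c" "a \<le> b" "b \<le> c"
    then show "0 \<le> a \<and> c \<le> 1 \<longrightarrow> comparable_on \<U> x p a c"
      using comparable_on_trans[OF x p, of a b c \<U>] by simp
  qed simp
  then show ?thesis by simp
qed

lemma spanier_subgroup_nearby_loop:
  assumes X: "locally_path_connected_space X" and \<U>: "open_cover X \<U>"
    and x: "x \<in> topspace X" and p: "p \<in> loops X x"
  obtains W where "openin (loop_space X x) W" "p \<in> W"
    "\<And>q. q \<in> W \<Longrightarrow> path_class p \<cdot> class_inv (path_class q) \<in> spanier_subgroup \<U> x"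
proof -
  let ?T = "compact_open_topology unit_interval X"
  have p': "p \<in> paths X" "p 0 = x" "p 1 = x" using p by (auto simp: loops_def)
  \<comment> \<open>A cover member at \<open>x\<close> is taken as the target neighbourhood at time
    1, so that the closing path \<open>d\<close> becomes a small loop.\<close>
  obtain U where U: "U \<in> \<U>" "openin X U" "x \<in> U"
    using \<U> x by (auto simp: open_cover_def)
  obtain V where V: "p 0 \<in> V" and V': "\<And>V'. openin X V' \<Longrightarrow> p 1 \<in> V' \<Longrightarrow>
      \<exists>W. openin ?T W \<and> p \<in> W \<and> (\<forall>q\<in>W. transports \<U> x 0 1 V V' p q)"
    by (rule comparable_onE[OF comparable_on_unit_interval[OF X \<U> x p'(1)]]) (rule that; blast)
  have "p 1 \<in> U" using U(3) p'(3) by simp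
  then obtain W where W: "openin ?T W" "p \<in> W"
    and WU: "\<And>q. q \<in> W \<Longrightarrow> transports \<U> x 0 1 V U p q"
    using V'[OF U(2)] by blast
  show ?thesis
  proof (rule that[of "W \<inter> loops X x"])
    show "openin (loop_space X x) (W \<inter> loops X x)"
      using W by (auto simp: loop_space_def openin_subtopology)
    show "p \<in> W \<inter> loops X x" using W p by simp
    fix q assume q: "q \<in> W \<inter> loops X x"
    then have q': "q \<in> paths X" "q 0 = x" "q 1 = x" by (auto simp: loops_def)
    \<comment> \<open>Both loops start at \<open>x\<close>, so the transport can begin with the
      constant path. It ends with a loop \<open>d\<close> in \<open>U\<close>, which is congruent to
      the constant one, and therefore \<open>p ~ p d ~ q\<close>.\<close>
    let ?k = "\<lambda>t\<in>{0..1::real}. x"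
    have k: "?k \<in> paths X" using x by (rule const_in_paths)
    have "?k ` {0..1} \<subseteq> V" "?k 0 = p 0" "?k 1 = q 0" using V p' q' by auto
    then obtain d where "d \<in> paths X" "d ` {0..1} \<subseteq> U" "d 0 = p 1" "d 1 = q 1"
      "spanier_cong \<U> x (p 0) (path_class (subpath_on p 0 1) \<cdot> path_class d)
        (path_class ?k \<cdot> path_class (subpath_on q 0 1))"
      using transportsD[OF WU k, of q] q by blast
    then have d: "d \<in> paths X" "d ` {0..1} \<subseteq> U" "d 0 = x" "d 1 = x"
      and cong_pq: "spanier_cong \<U> x x (path_class p \<cdot> path_class d) (class_one x \<cdot> path_class q)"
      using p' q' by (simp_all add: subpath_on_full class_one_def)
    have cong_one: "spanier_cong \<U> x x (class_one x) (path_class d)"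
      using spanier_cong_small[of ?k U d \<U> x] d k U by (auto simp: class_one_def)
    have classes: "path_class p \<in> path_classes x x" "path_class q \<in> path_classes x x"
      "path_class d \<in> path_classes x x"
      using p' q' d by (auto intro!: path_class_in_path_classes)
    have "spanier_cong \<U> x x (path_class p) (path_class p \<cdot> path_class d)"
      using spanier_cong_left[OF classes(1) class_one_closed[OF x] classes(3) cong_one]
        class_one_right[OF classes(1)] by simp
    moreover have "spanier_cong \<U> x x (path_class p \<cdot> path_class d) (path_class q)"
      using cong_pq class_one_left[OF classes(2)] by simp
    ultimately have "spanier_cong \<U> x x (path_class p) (path_class q)"
      by (rule spanier_cong_trans[OF x classes(1) class_comp_closed[OF classes(1,3)] classes(2)])
    \<comment> \<open>For loops at \<open>x\<close> the constant class is an admissible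
      \<open>C\<close>, which turns the congruence back into membership in the subgroup.\<close>
    then have "class_one x \<cdot> path_class p \<cdot> class_inv (class_one x \<cdot> path_class q)
        \<in> spanier_subgroup \<U> x"
      unfolding spanier_cong_def using class_one_closed[OF x] by (rule bspec)
    then show "path_class p \<cdot> class_inv (path_class q) \<in> spanier_subgroup \<U> x"
      using class_one_left[OF classes(1)] class_one_left[OF classes(2)] by simp
  qed
qed

end

section \<open>The coset topology of a normal subgroup\<close>

text \<open>For a subgroup \<open>N\<close> the open sets are exactly the unions of right cosets of
  \<open>N\<close>. Stated as stability under left multiplication by \<open>N\<close>, the topology
  axioms are immediate.\<close>

definition coset_topology :: "('g, 'b) monoid_scheme \<Rightarrow> 'g set \<Rightarrow> 'g topology" where
  "coset_topology G N = topology (\<lambda>V. V \<subseteq> carrier G \<and> (\<forall>a\<in>V. \<forall>n\<in>N. n \<otimes>\<^bsub>G\<^esub> a \<in> V))"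

lemma openin_coset_topology:
  "openin (coset_topology G N) V \<longleftrightarrow> V \<subseteq> carrier G \<and> (\<forall>a\<in>V. \<forall>n\<in>N. n \<otimes>\<^bsub>G\<^esub> a \<in> V)"
proof -
  have "istopology (\<lambda>V. V \<subseteq> carrier G \<and> (\<forall>a\<in>V. \<forall>n\<in>N. n \<otimes>\<^bsub>G\<^esub> a \<in> V))"
    unfolding istopology_def by (intro conjI allI impI; fast)
  then show ?thesis by (simp add: coset_topology_def)
qed

context normal
begin

lemma topspace_coset_topology: "topspace (coset_topology G H) = carrier G"
proof
  show "topspace (coset_topology G H) \<subseteq> carrier G"
    using openin_topspace[of "coset_topology G H"] unfolding openin_coset_topology by simp
  show "carrier G \<subseteq> topspace (coset_topology G H)"
    by (rule openin_subset) (use subset in \<open>auto simp: openin_coset_topology\<close>)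
qed

lemma openin_coset: "a \<in> carrier G \<Longrightarrow> openin (coset_topology G H) (H #> a)"
  unfolding openin_coset_topology
  by (auto simp: r_coset_def m_assoc[symmetric])

lemma mem_coset: "a \<in> carrier G \<Longrightarrow> a \<in> H #> a"
  by (rule rcos_self) (auto intro: subgroup_axioms)

text \<open>Normality gives both continuity statements:
  \<open>(n a) (m b) = n (a m a^-1) (a b)\<close> lies in the coset of \<open>a b\<close>, and
  \<open>(n a)^-1 = (a^-1 n^-1 a) a^-1\<close> in the coset of \<open>a^-1\<close>.\<close>

lemma topological_group_coset_topology: "topological_group G (coset_topology G H)"
  unfolding topological_group_def
proof (intro conjI)
  let ?T = "coset_topology G H"
  show "group G" by (rule is_group)
  show "topspace ?T = carrier G" by (rule topspace_coset_topology)
  show "continuous_map (prod_topology ?T ?T) ?T (\<lambda>(a, b). a \<otimes> b)"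
    unfolding continuous_map_def
  proof (intro conjI allI impI)
    fix W assume W: "openin ?T W"
    show "openin (prod_topology ?T ?T) {z \<in> topspace (prod_topology ?T ?T). (case z of (a, b) \<Rightarrow> a \<otimes> b) \<in> W}"
      unfolding openin_prod_topology_alt
    proof (intro allI impI)
      fix a b assume "(a, b) \<in> {z \<in> topspace (prod_topology ?T ?T). (case z of (a, b) \<Rightarrow> a \<otimes> b) \<in> W}"
      then have ab: "a \<in> carrier G" "b \<in> carrier G" "a \<otimes> b \<in> W"
        by (auto simp: topspace_coset_topology)
      have "(n \<otimes> a) \<otimes> (m \<otimes> b) \<in> W" if "n \<in> H" "m \<in> H" for n m
      proof -
        have "n \<otimes> (a \<otimes> m \<otimes> inv a) \<in> H" using that ab inv_op_closed2 by auto
        then have "n \<otimes> (a \<otimes> m \<otimes> inv a) \<otimes> (a \<otimes> b) \<in> W"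
          using W ab by (auto simp: openin_coset_topology)
        also have "n \<otimes> (a \<otimes> m \<otimes> inv a) \<otimes> (a \<otimes> b) = (n \<otimes> a) \<otimes> (m \<otimes> b)"
          using that ab by (simp add: m_assoc inv_solve_left' flip: m_assoc[of "inv a" a b])
        finally show ?thesis .
      qed
      then have "(H #> a) \<times> (H #> b) \<subseteq> {z \<in> topspace (prod_topology ?T ?T). (case z of (a, b) \<Rightarrow> a \<otimes> b) \<in> W}"
        using ab by (auto simp: r_coset_def topspace_coset_topology)
      then show "\<exists>U V. openin ?T U \<and> openin ?T V \<and> a \<in> U \<and> b \<in> V \<and>
          U \<times> V \<subseteq> {z \<in> topspace (prod_topology ?T ?T). (case z of (a, b) \<Rightarrow> a \<otimes> b) \<in> W}"
        using openin_coset mem_coset ab by blast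
    qed
  qed (auto simp: topspace_coset_topology)
  show "continuous_map ?T ?T (\<lambda>a. inv a)"
    unfolding continuous_map_def
  proof (intro conjI allI impI)
    fix W assume W: "openin ?T W"
    have "inv (n \<otimes> a) \<in> W" if "a \<in> carrier G" "inv a \<in> W" "n \<in> H" for a n
    proof -
      have "inv a \<otimes> inv n \<otimes> a \<in> H" using that inv_op_closed1 by auto
      then have "inv a \<otimes> inv n \<otimes> a \<otimes> inv a \<in> W"
        using W that by (auto simp: openin_coset_topology)
      also have "inv a \<otimes> inv n \<otimes> a \<otimes> inv a = inv (n \<otimes> a)"
        using that by (simp add: m_assoc inv_mult_group)
      finally show ?thesis .
    qed
    then show "openin ?T {a \<in> topspace ?T. inv a \<in> W}"
      by (auto simp: openin_coset_topology topspace_coset_topology)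
  qed (auto simp: topspace_coset_topology)
qed

end

section \<open>Comparison with the quotient topology and separation of points\<close>

lemma coset_topology_coarser_pi1_qtop:
  assumes X: "locally_path_connected_space X" and \<U>: "open_cover X \<U>" and x: "x \<in> topspace X"
  shows "coarser (coset_topology (fundamental_group X x) (spanier_subgroup X \<U> x)) (pi1_qtop X x)"
  unfolding coarser_def
proof (intro conjI allI impI)
  interpret N: normal "spanier_subgroup X \<U> x" "fundamental_group X x"
    by (rule spanier_subgroup_normal[OF x])
  show "topspace (coset_topology (fundamental_group X x) (spanier_subgroup X \<U> x))
      = topspace (pi1_qtop X x)"
    by (simp add: N.topspace_coset_topology topspace_pi1_qtop)
  fix V assume V: "openin (coset_topology (fundamental_group X x) (spanier_subgroup X \<U> x)) V"
  \<comment> \<open>Around each \<open>p\<close> in the preimage, every nearby \<open>q\<close> has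
    class \<open>[q] = ([p] [q]^-1)^-1 [p]\<close>, a left multiple of \<open>[p]\<close> by an
    element of the Spanier subgroup. Since \<open>V\<close> is stable under such multiples,
    \<open>q\<close> is in the preimage too.\<close>
  have "openin (loop_space X x) {p \<in> loops X x. loop_class X x p \<in> V}"
  proof (subst openin_subopen, intro ballI)
    fix p assume "p \<in> {p \<in> loops X x. loop_class X x p \<in> V}"
    then have p: "p \<in> loops X x" "path_class X p \<in> V"
      by (auto simp: loop_class_eq_path_class)
    obtain W where W: "openin (loop_space X x) W" "p \<in> W"
      and near: "\<And>q. q \<in> W \<Longrightarrow>
        class_comp X (path_class X p) (class_inv X (path_class X q)) \<in> spanier_subgroup X \<U> x"
      using spanier_subgroup_nearby_loop[OF X \<U> x p(1)] by blast
    have "q \<in> loops X x \<and> loop_class X x q \<in> V" if "q \<in> W" for q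
    proof
      show q: "q \<in> loops X x" using that openin_subset[OF W(1)] by auto
      have classes: "path_class X p \<in> path_classes X x x" "path_class X q \<in> path_classes X x x"
        using p q by (auto simp: loops_def path_classes_def)
      have "class_comp X (path_class X p) (class_inv X (path_class X q)) =
          path_class X p \<otimes>\<^bsub>fundamental_group X x\<^esub> inv\<^bsub>fundamental_group X x\<^esub> path_class X q"
        using classes x by (simp add: mult_fundamental_group inv_fundamental_group)
      then have "inv\<^bsub>fundamental_group X x\<^esub> (path_class X p \<otimes>\<^bsub>fundamental_group X x\<^esub>
          inv\<^bsub>fundamental_group X x\<^esub> path_class X q) \<in> spanier_subgroup X \<U> x"
        using near[OF that] by (metis N.m_inv_closed)
      then have "inv\<^bsub>fundamental_group X x\<^esub> (path_class X p \<otimes>\<^bsub>fundamental_group X x\<^esub>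
          inv\<^bsub>fundamental_group X x\<^esub> path_class X q) \<otimes>\<^bsub>fundamental_group X x\<^esub> path_class X p \<in> V"
        using V p by (auto simp: openin_coset_topology)
      moreover have "path_class X p \<in> carrier (fundamental_group X x)"
        "path_class X q \<in> carrier (fundamental_group X x)"
        using classes by (simp_all add: carrier_fundamental_group)
      ultimately have "path_class X q \<in> V"
        by (simp add: N.inv_mult_group N.m_assoc)
      then show "loop_class X x q \<in> V"
        using q by (simp add: loop_class_eq_path_class)
    qed
    with W show "\<exists>T. openin (loop_space X x) T \<and> p \<in> T \<and> T \<subseteq> {p \<in> loops X x. loop_class X x p \<in> V}"
      by (intro exI[of _ W]) auto
  qed
  moreover have "V \<subseteq> loop_class X x ` loops X x"
    using V openin_subset[OF V] N.topspace_coset_topology topspace_pi1_qtop[of X x]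
    by (simp add: pi1_qtop_def)
  ultimately show "openin (pi1_qtop X x) V"
    by (simp add: pi1_qtop_def openin_quotient_topology)
qed

theorem corollary5p3:
  fixes X :: "'a topology" and x :: 'a
  assumes "connected_space X"
    and "locally_path_connected_space X"
    and "x \<in> topspace X"
    and "spanier_group X x = {\<one>\<^bsub>fundamental_group X x\<^esub>}"
  shows "t1_space (pi1_tau X x)"
proof -
  let ?G = "fundamental_group X x"
  interpret group ?G by (rule group_fundamental_group[OF assms(3)])
  \<comment> \<open>Unique existence makes the \<open>THE\<close> in
    \<open>finest_group_topology\<close> denote, so the defining properties of the finest group
    topology become available.\<close>
  have "is_finest_group_topology ?G (pi1_qtop X x) (pi1_tau X x)"
    unfolding pi1_tau_def finest_group_topology_def
    by (rule theI'[OF ex1_finest_group_topology[OF is_group topspace_pi1_qtop]])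
  note finest_tau = this[unfolded is_finest_group_topology_def]
  have "topological_group ?G (pi1_tau X x)" using finest_tau by (rule conjunct1)
  then have top: "topspace (pi1_tau X x) = carrier ?G"
    unfolding topological_group_def by (elim conjE)
  \<comment> \<open>Maximality in the form needed below: it lets open sets of a coset topology pass
    to \<open>pi1_tau\<close>.\<close>
  have finest: "openin (pi1_tau X x) U"
    if "topological_group ?G T" "coarser T (pi1_qtop X x)" "openin T U" for T U
  proof -
    have "coarser T (pi1_tau X x)" using finest_tau that by blast
    then show ?thesis using that by (simp add: coarser_def)
  qed
  show ?thesis
    unfolding t1_space_def top
  proof (intro ballI impI)
    fix a b assume ab: "a \<in> carrier ?G" "b \<in> carrier ?G" "a \<noteq> b"
    then have "b \<otimes>\<^bsub>?G\<^esub> inv\<^bsub>?G\<^esub> a \<noteq> \<one>\<^bsub>?G\<^esub>"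
      using inv_equality[of b "inv\<^bsub>?G\<^esub> a"] by auto
    then have "b \<otimes>\<^bsub>?G\<^esub> inv\<^bsub>?G\<^esub> a \<notin> spanier_group X x"
      unfolding assms(4) by blast
    then obtain \<U> where \<U>: "open_cover X \<U>" "b \<otimes>\<^bsub>?G\<^esub> inv\<^bsub>?G\<^esub> a \<notin> spanier_group_cover X \<U> x"
      unfolding spanier_group_def by blast
    let ?N = "spanier_subgroup X \<U> x"
    interpret N: normal ?N ?G by (rule spanier_subgroup_normal[OF assms(3)])
    have "openin (pi1_tau X x) (?N #>\<^bsub>?G\<^esub> a)"
      using finest N.topological_group_coset_topology N.openin_coset[OF ab(1)]
        coset_topology_coarser_pi1_qtop[OF assms(2) \<U>(1) assms(3)] by blast
    moreover have "b \<notin> ?N #>\<^bsub>?G\<^esub> a"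
    proof
      assume "b \<in> ?N #>\<^bsub>?G\<^esub> a"
      \<comment> \<open>Solving \<open>b = n a\<close> for \<open>n\<close> gives
        \<open>n = b a^-1\<close>, which the chosen cover excludes from its Spanier
        subgroup.\<close>
      then obtain n where "n \<in> ?N" "b = n \<otimes>\<^bsub>?G\<^esub> a" by (auto simp: r_coset_def)
      then show False
        using \<U> ab by (simp add: m_assoc spanier_group_cover_eq[OF assms(3)])
    qed
    ultimately show "\<exists>U. openin (pi1_tau X x) U \<and> a \<in> U \<and> b \<notin> U"
      using N.mem_coset[OF ab(1)] by blast
  qed
qed

end
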